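(* Let $\mathcal{L}$ be a set of lines of the elliptic plane such that its polar set $p(\mathcal{L})=\{p(L) : L\in\mathcal{L}\}$ is a bounded, compact and full-dimensional subset of the elliptic plane. Among all conics with given center that contain $\mathcal{L}$ there exists exactly one of minimal measure.
   Context: The elliptic plane is the unit sphere $S^2\subset\mathbb{R}^3$ with antipodal points identified; its lines are the images of great circles (intersections of $S^2$ with two-dimensional linear subspaces), and area is inherited from $S^2$. The absolute pole $p(L)$ of a line $L$ is the point of the elliptic plane spanned by the normal vector of the plane defining $L$. The measure of a set $\mathcal{K}$ of lines is $m(\mathcal{K})=\operatorname{area}\{p(L) : L\in\mathcal{K}\}$. A conic is a set $C=\{x\in S^2 : x^{T}Mx=0\}$ where $M\in\mathbb{R}^{3\times 3}$ is symmetric, invertible and indefinite, scaled so that it has eigenvalues $\nu_1\ge\nu_2>0$ and $\nu_3=-1$. The center of $C$ is the point spanned by an eigenvector for the eigenvalue $-1$. A conic $C$ is said to contain a set $\mathcal{L}$ of lines if every $L\in\mathcal{L}$ has at most one real intersection point with $C$ (counted in the elliptic plane). The measure of a conic $C$ is the measure $m$ of the set of all lines that have at most one real intersection point with $C$. A set of points is called bounded if it is contained in a circle (a conic with $\nu_1=\nu_2$) in the sense that $x^TMx\le 0$ for all its points $x$, where $M$ is the matrix of the circle, and full-dimensional if it is not contained in a line.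
   Formalization: The formal theorem additionally assumes that at least one conic with the given center contains the set of lines; without this the claim fails, e.g. when the polar set is a small disc around a point orthogonal to the given center, since then no such conic exists. *)

theory Defs
  imports "HOL-Analysis.Analysis"
begin

abbreviation S2 :: "(real^3) set"
  where "S2 \<equiv> sphere 0 1"


section \<open>The elliptic plane\<close>

text \<open>A point of the elliptic plane is an unordered pair of antipodal unit vectors.\<close>

type_synonym elliptic_point = "(real^3) set"

definition proj :: "real^3 \<Rightarrow> elliptic_point"
  where "proj x = {x, - x}"

definition elliptic_plane :: "elliptic_point set"
  where "elliptic_plane = proj ` S2"

definition elliptic_topology :: "elliptic_point topology"
  where "elliptic_topology =
    topology (\<lambda>U. U \<subseteq> elliptic_plane \<and> openin (top_of_set S2) {x \<in> S2. proj x \<in> U})"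

lemma openin_elliptic_topology:
  "openin elliptic_topology U \<longleftrightarrow>
     U \<subseteq> elliptic_plane \<and> openin (top_of_set S2) {x \<in> S2. proj x \<in> U}"
proof -
  have "istopology (\<lambda>U. U \<subseteq> elliptic_plane \<and> openin (top_of_set S2) {x \<in> S2. proj x \<in> U})"
    unfolding istopology_def
  proof (intro conjI allI impI)
    fix U V :: "elliptic_point set"
    assume U: "U \<subseteq> elliptic_plane \<and> openin (top_of_set S2) {x \<in> S2. proj x \<in> U}"
      and V: "V \<subseteq> elliptic_plane \<and> openin (top_of_set S2) {x \<in> S2. proj x \<in> V}"
    have "{x \<in> S2. proj x \<in> U \<inter> V} = {x \<in> S2. proj x \<in> U} \<inter> {x \<in> S2. proj x \<in> V}"
      by auto
    then show "openin (top_of_set S2) {x \<in> S2. proj x \<in> U \<inter> V}"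
      using U V by (simp only: openin_Int)
    show "U \<inter> V \<subseteq> elliptic_plane" using U by auto
  next
    fix \<K> :: "elliptic_point set set"
    assume K: "\<forall>U\<in>\<K>. U \<subseteq> elliptic_plane \<and> openin (top_of_set S2) {x \<in> S2. proj x \<in> U}"
    have "{x \<in> S2. proj x \<in> \<Union>\<K>} = (\<Union>U\<in>\<K>. {x \<in> S2. proj x \<in> U})"
      by auto
    then show "openin (top_of_set S2) {x \<in> S2. proj x \<in> \<Union>\<K>}"
      using K by (simp only:) (rule openin_Union, auto)
    show "\<Union>\<K> \<subseteq> elliptic_plane" using K by auto
  qed
  then show ?thesis
    by (simp add: elliptic_topology_def topology_inverse')
qed

lemma quotient_map_proj: "quotient_map (top_of_set S2) elliptic_topology proj"
proof -
  have "openin elliptic_topology elliptic_plane"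
    unfolding openin_elliptic_topology
  proof
    have "{x \<in> S2. proj x \<in> elliptic_plane} = S2"
      by (auto simp: elliptic_plane_def)
    then show "openin (top_of_set S2) {x \<in> S2. proj x \<in> elliptic_plane}"
      by simp
  qed simp
  then have "topspace elliptic_topology = elliptic_plane"
    by (metis openin_elliptic_topology openin_subset openin_topspace subset_antisym)
  then show ?thesis
    by (auto simp: quotient_map_def openin_elliptic_topology elliptic_plane_def)
qed


section \<open>Lines and poles\<close>

definition line_of_plane :: "(real^3) set \<Rightarrow> elliptic_point set"
  where "line_of_plane W = proj ` (S2 \<inter> W)"

definition elliptic_lines :: "elliptic_point set set"
  where "elliptic_lines = {line_of_plane W | W. subspace W \<and> dim W = 2}"

definition pole :: "elliptic_point set \<Rightarrow> elliptic_point"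
  where "pole L = (THE p. \<exists>W n. subspace W \<and> dim W = 2 \<and> L = line_of_plane W \<and>
                      n \<in> S2 \<and> (\<forall>w\<in>W. n \<bullet> w = 0) \<and> p = proj n)"


section \<open>Area and the measure of sets of lines\<close>

text \<open>
  In polar coordinates \<open>dV = r\<^sup>2 dr d\<sigma>\<close>, so the cone over \<open>A\<close> with apex \<open>0\<close> has one third of
  the area of \<open>A\<close> as its volume.
\<close>

definition sphere_area :: "(real^3) set \<Rightarrow> real"
  where "sphere_area A = 3 * measure lebesgue {t *\<^sub>R x | t x. 0 \<le> t \<and> t \<le> 1 \<and> x \<in> A}"

text \<open>Every point of the elliptic plane has two preimages on the sphere, hence the factor.\<close>

definition elliptic_area :: "elliptic_point set \<Rightarrow> real"
  where "elliptic_area K = sphere_area {x \<in> S2. proj x \<in> K} / 2"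

definition line_measure :: "elliptic_point set set \<Rightarrow> real"
  where "line_measure \<K> = elliptic_area (pole ` \<K>)"


section \<open>Conics\<close>

text \<open>
  The eigenvalues are counted with multiplicity, as roots of the characteristic polynomial.
  Their signs make the matrix invertible and indefinite.
\<close>

definition conic_matrix :: "real^3^3 \<Rightarrow> real \<Rightarrow> real \<Rightarrow> bool"
  where "conic_matrix M \<nu>1 \<nu>2 \<longleftrightarrow>
    transpose M = M \<and> \<nu>1 \<ge> \<nu>2 \<and> \<nu>2 > 0 \<and>
    (\<forall>t. det (mat t - M) = (t - \<nu>1) * (t - \<nu>2) * (t - (- 1)))"

definition conic_of :: "real^3^3 \<Rightarrow> (real^3) set"
  where "conic_of M = {x \<in> S2. x \<bullet> (M *v x) = 0}"

definition conic_with_center :: "(real^3) set \<Rightarrow> elliptic_point \<Rightarrow> bool"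
  where "conic_with_center C c \<longleftrightarrow>
    (\<exists>M \<nu>1 \<nu>2 e. conic_matrix M \<nu>1 \<nu>2 \<and> C = conic_of M \<and>
                  e \<in> S2 \<and> M *v e = - e \<and> c = proj e)"

definition at_most_one_intersection :: "(real^3) set \<Rightarrow> elliptic_point set \<Rightarrow> bool"
  where "at_most_one_intersection C L \<longleftrightarrow> (\<exists>\<^sub>\<le>\<^sub>1 p. p \<in> L \<inter> proj ` C)"

definition contains_lines :: "(real^3) set \<Rightarrow> elliptic_point set set \<Rightarrow> bool"
  where "contains_lines C \<L> \<longleftrightarrow> (\<forall>L\<in>\<L>. at_most_one_intersection C L)"

definition conic_measure :: "(real^3) set \<Rightarrow> real"
  where "conic_measure C = line_measure {L \<in> elliptic_lines. at_most_one_intersection C L}"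


section \<open>Bounded and full-dimensional sets of points\<close>

definition elliptic_bounded :: "elliptic_point set \<Rightarrow> bool"
  where "elliptic_bounded K \<longleftrightarrow>
    (\<exists>M \<nu>. conic_matrix M \<nu> \<nu> \<and> (\<forall>x\<in>S2. proj x \<in> K \<longrightarrow> x \<bullet> (M *v x) \<le> 0))"

definition full_dimensional :: "elliptic_point set \<Rightarrow> bool"
  where "full_dimensional K \<longleftrightarrow> \<not> (\<exists>L\<in>elliptic_lines. K \<subseteq> L)"


section \<open>Consistency of the definitions\<close>

lemma proj_eq_iff: "proj x = proj y \<longleftrightarrow> x = y \<or> x = - y"
  by (auto simp: proj_def doubleton_eq_iff)

lemma proj_mem_line_of_plane:
  assumes "subspace W" "x \<in> S2"
  shows "proj x \<in> line_of_plane W \<longleftrightarrow> x \<in> W"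
proof
  assume "proj x \<in> line_of_plane W"
  then obtain y where "y \<in> W" "x = y \<or> x = - y"
    by (auto simp: line_of_plane_def proj_eq_iff)
  then show "x \<in> W"
    using assms(1) subspace_neg by blast
next
  assume "x \<in> W"
  then show "proj x \<in> line_of_plane W"
    using assms(2) by (auto simp: line_of_plane_def)
qed

lemma line_of_plane_inject:
  assumes "subspace V" "subspace W" "line_of_plane V = line_of_plane W"
  shows "V = W"
proof -
  have sub: "V \<subseteq> W" if "subspace V" "subspace W" "line_of_plane V = line_of_plane W" for V W
  proof
    fix x assume x: "x \<in> V"
    show "x \<in> W"
    proof (cases "x = 0")
      case True
      then show ?thesis using that subspace_0 by blast
    next
      case False
      let ?u = "(1 / norm x) *\<^sub>R x"
      have u: "?u \<in> S2" using False by simp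
      have "?u \<in> V" using that(1) x by (simp only: subspace_scale)
      then have "?u \<in> W"
        using that u proj_mem_line_of_plane by metis
      then have "norm x *\<^sub>R ?u \<in> W"
        using that(2) by (simp only: subspace_scale)
      then show ?thesis using False by simp
    qed
  qed
  show ?thesis
    using sub[OF assms] sub[OF assms(2,1) assms(3)[symmetric]] by (rule subset_antisym)
qed

lemma pole_line_of_plane:
  assumes W: "subspace W" "dim W = 2" and n: "n \<in> S2" "\<forall>w\<in>W. n \<bullet> w = 0"
  shows "pole (line_of_plane W) = proj n"
  unfolding pole_def
proof (rule the_equality)
  show "\<exists>V m. subspace V \<and> dim V = 2 \<and> line_of_plane W = line_of_plane V \<and>
          m \<in> S2 \<and> (\<forall>w\<in>V. m \<bullet> w = 0) \<and> proj n = proj m"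
    using assms by blast
next
  fix p
  assume "\<exists>V m. subspace V \<and> dim V = 2 \<and> line_of_plane W = line_of_plane V \<and>
            m \<in> S2 \<and> (\<forall>w\<in>V. m \<bullet> w = 0) \<and> p = proj m"
  then obtain m where m: "m \<in> S2" "\<forall>w\<in>W. m \<bullet> w = 0" and p: "p = proj m"
    using line_of_plane_inject W(1) by metis
  let ?N = "{y. \<forall>w\<in>W. orthogonal w y}"
  have "dim {y \<in> UNIV. \<forall>w\<in>W. orthogonal w y} + dim W = dim (UNIV :: (real^3) set)"
    using W(1) by (intro dim_subspace_orthogonal_to_vectors) auto
  then have "dim ?N = 1"
    using W(2) by simp
  moreover have "n \<in> ?N" "m \<in> ?N"
    using n m by (auto simp: orthogonal_def inner_commute)
  moreover have "n \<noteq> 0"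
    using n(1) by auto
  ultimately have "?N \<subseteq> span {n}"
    by (intro card_ge_dim_independent) auto
  then obtain k where k: "m = k *\<^sub>R n"
    using \<open>m \<in> ?N\<close> by (auto simp: span_singleton)
  then have "\<bar>k\<bar> = 1"
    using n(1) m(1) by simp
  then show "p = proj n"
    using k p by (auto simp: proj_eq_iff abs_if split: if_splits)
qed

lemma sphere_area_S2: "sphere_area S2 = 4 * pi"
proof -
  have "{t *\<^sub>R x | t x. 0 \<le> t \<and> t \<le> 1 \<and> x \<in> S2} = cball (0 :: real^3) 1"
  proof (intro equalityI subsetI)
    fix y :: "real^3" assume "y \<in> {t *\<^sub>R x | t x. 0 \<le> t \<and> t \<le> 1 \<and> x \<in> S2}"
    then show "y \<in> cball 0 1" by auto
  next
    fix y :: "real^3" assume y: "y \<in> cball 0 1"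
    obtain a :: "real^3" where a: "norm a = 1"
      using vector_choose_size[of 1] by auto
    show "y \<in> {t *\<^sub>R x | t x. 0 \<le> t \<and> t \<le> 1 \<and> x \<in> S2}"
    proof (cases "y = 0")
      case True
      then have "y = 0 *\<^sub>R a" "a \<in> S2" using a by auto
      then show ?thesis by (intro CollectI exI[of _ 0] exI[of _ a]) auto
    next
      case False
      then have "y = norm y *\<^sub>R ((1 / norm y) *\<^sub>R y)" "(1 / norm y) *\<^sub>R y \<in> S2" by auto
      then show ?thesis
        using y by (intro CollectI exI[of _ "norm y"] exI[of _ "(1 / norm y) *\<^sub>R y"]) auto
    qed
  qed
  then show ?thesis
    by (simp add: sphere_area_def content_cball unit_ball_vol_3)
qed

end

theory Submission
  imports Defs
begin

text \<open>
  Choose orthonormal coordinates whose third axis is the given center. A conic with this center is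
  \<open>B(x, y) = z\<^sup>2\<close> for a positive definite binary quadratic form \<open>B\<close>, and a line with pole \<open>n\<close>
  meets it at most once iff \<open>n\<close> lies in the cone \<open>A(x, y) \<le> z\<^sup>2\<close> of the dual form
  \<open>A = inverse B\<close> (\<open>isotropic_in_plane_at_most_one\<close>). Containing the given lines is therefore a
  family of linear inequalities on \<open>A\<close>, and the measure of the conic is three halves of the volume
  that this cone has in the unit ball.

  The point is that the volume is a strictly convex function of \<open>A\<close>. Over \<open>w\<close> in the plane
  \<open>z = 0\<close> the upper half of the cone has height
  \<open>max 0 (sqrt (1 - \<bar>w\<bar>\<^sup>2) - sqrt (A w))\<close>, and \<open>sqrt\<close> is strictly concave while \<open>A w\<close> is
  linear in \<open>A\<close>. Hence two different minimizers would have a better midpoint.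

  For existence, admit positive semidefinite forms as well. The admissible forms are then a closed
  set, and it is bounded because the poles are not all on one line. So the continuous volume attains
  its minimum. A degenerate form \<open>A\<close> is never a minimizer (\<open>degenerate_not_minimal\<close>): move
  from \<open>A\<close> towards a definite admissible form by a small fraction \<open>t\<close>. By convexity the height
  grows by at most \<open>t\<close> at each point, so at most a multiple of \<open>t\<close> is added to the volume; but near
  the kernel of \<open>A\<close>, where \<open>sqrt\<close> has infinite slope, the volume lost is of the order
  \<open>t ln (1 / t)\<close>.
\<close>

section \<open>Binary quadratic forms\<close>

text \<open>
  The triple \<open>(a, b, c)\<close> stands for the symmetric matrix with rows \<open>(a, b)\<close> and \<open>(b, c)\<close>;
  triples carry the vector space structure in which convexity is meant.
\<close>

definition binary_form :: "real \<times> real \<times> real \<Rightarrow> real \<times> real \<Rightarrow> real"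
  where "binary_form A w = (case A of (a, b, c) \<Rightarrow>
    a * (fst w)\<^sup>2 + 2 * b * fst w * snd w + c * (snd w)\<^sup>2)"

definition pos_semidef :: "real \<times> real \<times> real \<Rightarrow> bool"
  where "pos_semidef A \<longleftrightarrow> (\<forall>w. 0 \<le> binary_form A w)"

definition pos_def :: "real \<times> real \<times> real \<Rightarrow> bool"
  where "pos_def A \<longleftrightarrow> (\<forall>w. w \<noteq> 0 \<longrightarrow> 0 < binary_form A w)"

lemma pos_semidefD: "pos_semidef A \<Longrightarrow> 0 \<le> binary_form A w"
  by (simp only: pos_semidef_def)

lemma binary_form_combination:
  "binary_form (s *\<^sub>R A + t *\<^sub>R B) w = s * binary_form A w + t * binary_form B w"
  by (simp add: binary_form_def case_prod_unfold algebra_simps)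

lemma binary_form_scaleR: "binary_form A (r *\<^sub>R w) = r\<^sup>2 * binary_form A w"
  by (simp add: binary_form_def case_prod_unfold algebra_simps power2_eq_square)

lemma pos_def_imp_pos_semidef: "pos_def A \<Longrightarrow> pos_semidef A"
  unfolding pos_def_def pos_semidef_def
  by (metis binary_form_scaleR[of A 0 0] scale_zero_left mult_zero_left zero_power2 less_le order_refl)

text \<open>
  For \<open>\<alpha> > 0\<close> the discriminant inequality is the value of the form at \<open>(\<beta>, - \<alpha>)\<close>. For
  \<open>\<alpha> = 0\<close> the form is affine along the line \<open>y = 1\<close>, so nonnegativity forces \<open>\<beta> = 0\<close>.
\<close>

lemma pos_semidef_discriminant:
  assumes "pos_semidef (\<alpha>, \<beta>, \<gamma>)"
  shows "0 \<le> \<alpha>" "0 \<le> \<gamma>" "\<beta>\<^sup>2 \<le> \<alpha> * \<gamma>"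
proof -
  show \<alpha>: "0 \<le> \<alpha>" using pos_semidefD[OF assms, of "(1, 0)"] by (simp add: binary_form_def)
  show "0 \<le> \<gamma>" using pos_semidefD[OF assms, of "(0, 1)"] by (simp add: binary_form_def)
  show "\<beta>\<^sup>2 \<le> \<alpha> * \<gamma>"
  proof (cases "\<alpha> = 0")
    case True
    have "\<beta> = 0"
    proof (rule ccontr)
      assume "\<beta> \<noteq> 0"
      then show False
        using pos_semidefD[OF assms, of "(- (\<gamma> + 1) / (2 * \<beta>), 1)"] True by (simp add: binary_form_def)
    qed
    then show ?thesis using True by simp
  next
    case False
    have "binary_form (\<alpha>, \<beta>, \<gamma>) (\<beta>, - \<alpha>) = \<alpha> * (\<alpha> * \<gamma> - \<beta>\<^sup>2)"
      by (simp add: binary_form_def power2_eq_square algebra_simps)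
    then have "0 \<le> \<alpha> * (\<alpha> * \<gamma> - \<beta>\<^sup>2)" using pos_semidefD[OF assms] by metis
    then show ?thesis using False \<alpha> by (simp add: zero_le_mult_iff)
  qed
qed

lemma pos_def_iff: "pos_def (\<alpha>, \<beta>, \<gamma>) \<longleftrightarrow> 0 < \<alpha> \<and> \<beta>\<^sup>2 < \<alpha> * \<gamma>"
proof
  assume pos_def: "pos_def (\<alpha>, \<beta>, \<gamma>)"
  then have "0 < binary_form (\<alpha>, \<beta>, \<gamma>) (1, 0)" unfolding pos_def_def by (auto simp: prod_eq_iff)
  then have \<alpha>: "0 < \<alpha>" by (simp add: binary_form_def)
  then have "0 < binary_form (\<alpha>, \<beta>, \<gamma>) (\<beta>, - \<alpha>)"
    using pos_def unfolding pos_def_def by (auto simp: prod_eq_iff)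
  also have "binary_form (\<alpha>, \<beta>, \<gamma>) (\<beta>, - \<alpha>) = \<alpha> * (\<alpha> * \<gamma> - \<beta>\<^sup>2)"
    by (simp add: binary_form_def power2_eq_square algebra_simps)
  finally show "0 < \<alpha> \<and> \<beta>\<^sup>2 < \<alpha> * \<gamma>" using \<alpha> by (simp add: zero_less_mult_iff)
next
  assume *: "0 < \<alpha> \<and> \<beta>\<^sup>2 < \<alpha> * \<gamma>"
  show "pos_def (\<alpha>, \<beta>, \<gamma>)"
    unfolding pos_def_def
  proof (intro allI impI)
    fix w :: "real \<times> real" assume w: "w \<noteq> 0"
    obtain x y where xy: "w = (x, y)" by (cases w)
    have "\<alpha> * binary_form (\<alpha>, \<beta>, \<gamma>) w = (\<alpha> * x + \<beta> * y)\<^sup>2 + (\<alpha> * \<gamma> - \<beta>\<^sup>2) * y\<^sup>2"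
      by (simp add: xy binary_form_def power2_eq_square algebra_simps)
    moreover have "0 < (\<alpha> * x + \<beta> * y)\<^sup>2 + (\<alpha> * \<gamma> - \<beta>\<^sup>2) * y\<^sup>2"
    proof (cases "y = 0")
      case True
      then have "x \<noteq> 0" using w xy by (auto simp: prod_eq_iff)
      then show ?thesis using True * by simp
    next
      case False
      then show ?thesis using * by (intro add_nonneg_pos mult_pos_pos) auto
    qed
    ultimately have "0 < \<alpha> * binary_form (\<alpha>, \<beta>, \<gamma>) w" by (simp only:)
    then show "0 < binary_form (\<alpha>, \<beta>, \<gamma>) w" using * zero_less_mult_pos by blast
  qed
qed

lemma continuous_binary_form [continuous_intros]:
  "continuous_on S (binary_form A)"
  unfolding binary_form_def case_prod_unfold by (intro continuous_intros)

lemma continuous_binary_form_coeffs: "continuous_on S (\<lambda>A. binary_form A w)"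
  unfolding binary_form_def case_prod_unfold by (intro continuous_intros)

lemma binary_form_eqI:
  assumes "\<And>w. binary_form A w = binary_form B w"
  shows "A = B"
  using assms[of "(1,0)"] assms[of "(0,1)"] assms[of "(1,1)"]
  by (simp add: binary_form_def case_prod_unfold prod_eq_iff)

section \<open>Convexity and continuity of the volume\<close>

text \<open>
  This is the length of the set of all \<open>z \<ge> 0\<close> such that the point with coordinates \<open>w\<close> and
  \<open>z\<close> lies in the unit ball and satisfies \<open>A w \<le> z\<^sup>2\<close>, for semidefinite \<open>A\<close>. Outside the unit
  disc the first root is that of a negative number, hence negative, and the length is zero.
\<close>

definition fiber_height :: "real \<times> real \<times> real \<Rightarrow> real \<times> real \<Rightarrow> real"
  where "fiber_height A w = max 0 (sqrt (1 - (norm w)\<^sup>2) - sqrt (binary_form A w))"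

abbreviation square :: "(real \<times> real) set"
  where "square \<equiv> cbox (-1, -1) (1, 1)"

text \<open>
  The square contains the unit disc. Integrating over it instead of the disc leaves the value
  unchanged and allows iterated integration.
\<close>

definition half_cone_volume :: "real \<times> real \<times> real \<Rightarrow> real"
  where "half_cone_volume A = integral square (fiber_height A)"

lemma continuous_fiber_height: "continuous_on S (fiber_height A)"
  unfolding fiber_height_def by (intro continuous_intros)

lemma fiber_height_integrable: "fiber_height A integrable_on square"
  by (intro integrable_continuous continuous_fiber_height)

lemma sqrt_concave:
  assumes "0 \<le> a" "0 \<le> b" "0 \<le> t" "t \<le> (1::real)"
  shows "(1 - t) * sqrt a + t * sqrt b \<le> sqrt ((1 - t) * a + t * b)"
proof (rule real_le_rsqrt)
  have "(1 - t) * (sqrt a)\<^sup>2 + t * (sqrt b)\<^sup>2 - ((1 - t) * sqrt a + t * sqrt b)\<^sup>2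
      = t * (1 - t) * (sqrt a - sqrt b)\<^sup>2"
    by (simp add: power2_eq_square algebra_simps)
  also have "\<dots> \<ge> 0" using assms by simp
  finally show "((1 - t) * sqrt a + t * sqrt b)\<^sup>2 \<le> (1 - t) * a + t * b"
    using assms by simp
qed

lemma sqrt_strictly_midpoint_concave:
  assumes "0 \<le> a" "0 \<le> b" "a \<noteq> (b::real)"
  shows "(sqrt a + sqrt b) / 2 < sqrt ((a + b) / 2)"
proof (rule real_less_rsqrt)
  have "((sqrt a)\<^sup>2 + (sqrt b)\<^sup>2) / 2 - ((sqrt a + sqrt b) / 2)\<^sup>2 = (sqrt a - sqrt b)\<^sup>2 / 4"
    by (simp add: power2_eq_square field_simps)
  also have "\<dots> > 0" using assms by simp
  finally show "((sqrt a + sqrt b) / 2)\<^sup>2 < (a + b) / 2"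
    using assms by simp
qed

lemma fiber_height_convex:
  assumes "pos_semidef A" "pos_semidef B" "0 \<le> t" "t \<le> 1"
  shows "fiber_height ((1 - t) *\<^sub>R A + t *\<^sub>R B) w \<le> (1 - t) * fiber_height A w + t * fiber_height B w"
proof -
  let ?r = "sqrt (1 - (norm w)\<^sup>2)"
  have "?r - sqrt (binary_form ((1 - t) *\<^sub>R A + t *\<^sub>R B) w)
      \<le> (1 - t) * (?r - sqrt (binary_form A w)) + t * (?r - sqrt (binary_form B w))"
    using sqrt_concave[of "binary_form A w" "binary_form B w" t] assms pos_semidefD[of A w] pos_semidefD[of B w]
    by (simp only: binary_form_combination) argo
  also have "\<dots> \<le> (1 - t) * fiber_height A w + t * fiber_height B w"
    using assms by (intro add_mono mult_left_mono) (auto simp: fiber_height_def)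
  moreover have "0 \<le> (1 - t) * fiber_height A w + t * fiber_height B w"
    using assms by (auto simp: fiber_height_def)
  ultimately show ?thesis by (simp add: fiber_height_def)
qed

text \<open>
  The two forms differ in some direction, and on a short vector \<open>w\<close> in that direction neither
  height is cut off at zero. There strict concavity of the root makes the midpoint inequality strict,
  and continuity carries the strictness over to the integral.
\<close>

lemma half_cone_volume_strictly_midpoint_convex:
  assumes "pos_semidef A" "pos_semidef B" "A \<noteq> B"
  shows "2 * half_cone_volume ((1/2) *\<^sub>R A + (1/2) *\<^sub>R B) < half_cone_volume A + half_cone_volume B"
proof -
  let ?C = "(1/2) *\<^sub>R A + (1/2) *\<^sub>R B"
  define f where "f w = fiber_height A w + fiber_height B w - 2 * fiber_height ?C w" for w
  have f_nonneg: "0 \<le> f w" for w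
    using fiber_height_convex[of A B "1/2" w] assms by (simp add: f_def)
  have f_cont: "continuous_on square f"
    unfolding f_def by (intro continuous_intros continuous_fiber_height)
  have f_int: "(f has_integral half_cone_volume A + half_cone_volume B - 2 * half_cone_volume ?C) square"
    unfolding f_def half_cone_volume_def
    by (intro has_integral_diff has_integral_add has_integral_mult_right
        integrable_integral fiber_height_integrable)
  obtain v where v: "binary_form A v \<noteq> binary_form B v"
    using binary_form_eqI assms(3) by blast
  \<comment> \<open>Scaling by \<open>1 / sqrt (1 + K)\<close> makes \<open>\<bar>w\<bar>\<^sup>2 + A w + B w < 1\<close>, so that both heights are positive.\<close>
  define K where "K = (norm v)\<^sup>2 + binary_form A v + binary_form B v"
  define w where "w = (1 / sqrt (1 + K)) *\<^sub>R v"
  have nonneg: "0 \<le> binary_form A u" "0 \<le> binary_form B u" for u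
    using assms by (auto intro: pos_semidefD)
  have K: "0 \<le> K" unfolding K_def using nonneg[of v] by simp
  have e: "(1 / sqrt (1 + K))\<^sup>2 = 1 / (1 + K)"
    using K by (simp add: power_divide)
  have w_forms: "(norm w)\<^sup>2 = (norm v)\<^sup>2 / (1 + K)" "binary_form A w = binary_form A v / (1 + K)"
    "binary_form B w = binary_form B v / (1 + K)"
    unfolding w_def binary_form_scaleR e by (simp_all add: power_mult_distrib power_divide e K)
  have "(norm w)\<^sup>2 + binary_form A w + binary_form B w = K / (1 + K)"
    unfolding w_forms K_def by (simp add: add_divide_distrib)
  also have "\<dots> < 1" using K by simp
  finally have small: "(norm w)\<^sup>2 + binary_form A w + binary_form B w < 1" .
  have neq: "binary_form A w \<noteq> binary_form B w"
    using v K by (simp add: w_forms)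
  let ?r = "sqrt (1 - (norm w)\<^sup>2)"
  have "binary_form ?C w = (binary_form A w + binary_form B w) / 2"
    by (simp add: binary_form_combination)
  then have strict: "(sqrt (binary_form A w) + sqrt (binary_form B w)) / 2 < sqrt (binary_form ?C w)"
    using sqrt_strictly_midpoint_concave[OF nonneg[of w] neq] by (simp only:)
  have less: "sqrt (binary_form A w) < ?r" "sqrt (binary_form B w) < ?r"
    using small nonneg[of w] by (simp_all del: norm_power)
  have "0 < f w"
    using strict less unfolding f_def fiber_height_def max_def by argo
  have "(norm w)\<^sup>2 \<le> 1"
    using small nonneg[of w] by linarith
  then have "norm w \<le> 1" using power2_le_imp_le[of "norm w" 1] by simp
  then have "\<bar>fst w\<bar> \<le> 1" "\<bar>snd w\<bar> \<le> 1"
    using norm_fst_le[of "fst w" "snd w"] norm_snd_le[of "snd w" "fst w"] by auto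
  then have "w \<in> square" by (cases w) (auto simp: cbox_Pair_eq)
  moreover have "box (-1, -1) (1, 1) \<noteq> ({} :: (real \<times> real) set)"
    by (auto simp: box_eq_empty Basis_prod_def)
  ultimately have "half_cone_volume A + half_cone_volume B - 2 * half_cone_volume ?C \<noteq> 0"
    using has_integral_0_cbox_imp_0[OF f_cont f_nonneg _ _ \<open>w \<in> square\<close>] f_int \<open>0 < f w\<close>
    by (metis less_irrefl)
  moreover have "half_cone_volume A + half_cone_volume B - 2 * half_cone_volume ?C \<ge> 0"
    using f_int f_nonneg has_integral_nonneg by blast
  ultimately show ?thesis by linarith
qed

lemma continuous_half_cone_volume: "continuous_on S half_cone_volume"
proof -
  have "continuous_on (S \<times> square) (\<lambda>(A, w). fiber_height A w)"
    unfolding fiber_height_def binary_form_def case_prod_unfold by (intro continuous_intros)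
  then show ?thesis
    unfolding half_cone_volume_def by (rule integral_continuous_on_param)
qed

section \<open>Degenerate forms are not minimal\<close>

lemma half_cone_volume_iterated:
  "half_cone_volume A = integral {-1..1} (\<lambda>x. integral {-1..1} (\<lambda>y. fiber_height A (x, y)))"
  unfolding half_cone_volume_def
  by (subst integral_prod_continuous) (simp_all add: continuous_fiber_height)

lemma half_cone_volume_swap: "half_cone_volume (c, b, a) = half_cone_volume (a, b, c)"
proof -
  have swap: "fiber_height (c, b, a) (x, y) = fiber_height (a, b, c) (y, x)" for x y
    by (simp add: fiber_height_def binary_form_def norm_Pair algebra_simps)
  have "integral (cbox (-1) 1) (\<lambda>x. integral (cbox (-1) 1) (\<lambda>y. fiber_height (c, b, a) (x, y)))
      = integral (cbox (-1) 1) (\<lambda>y. integral (cbox (-1) 1) (\<lambda>x. fiber_height (c, b, a) (x, y)))"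
    by (rule integral_swap_continuous) (simp add: continuous_fiber_height)
  then show ?thesis by (simp add: half_cone_volume_iterated swap)
qed

text \<open>
  This is the source of the logarithm that beats the linear loss: with \<open>\<sigma>\<close> of the order of
  \<open>sqrt t\<close>, the integral grows without bound as \<open>t\<close> tends to zero.
\<close>

lemma integral_reciprocal_linear:
  fixes k \<sigma> \<eta> \<mu> l :: real
  assumes "0 < k" "0 < \<sigma>" "0 \<le> \<eta>"
  shows "((\<lambda>y. \<mu> / (k * (y - l) + \<sigma>)) has_integral \<mu> / k * ln ((k * \<eta> + \<sigma>) / \<sigma>)) {l..l + \<eta>}"
proof -
  have pos: "0 < k * (y - l) + \<sigma>" if "y \<in> {l..l + \<eta>}" for y
    using that assms by (intro add_nonneg_pos mult_nonneg_nonneg) auto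
  have "((\<lambda>y. \<mu> / (k * (y - l) + \<sigma>)) has_integral
      \<mu> / k * ln (k * (l + \<eta> - l) + \<sigma>) - \<mu> / k * ln (k * (l - l) + \<sigma>)) {l..l + \<eta>}"
  proof (rule fundamental_theorem_of_calculus)
    fix y assume y: "y \<in> {l..l + \<eta>}"
    have "((\<lambda>y. \<mu> / k * ln (k * (y - l) + \<sigma>)) has_real_derivative
        \<mu> / k * (k / (k * (y - l) + \<sigma>))) (at y within {l..l + \<eta>})"
      using pos[OF y] by (auto intro!: derivative_eq_intros)
    also have "\<mu> / k * (k / (k * (y - l) + \<sigma>)) = \<mu> / (k * (y - l) + \<sigma>)"
      using assms(1) by simp
    finally have "((\<lambda>y. \<mu> / k * ln (k * (y - l) + \<sigma>)) has_real_derivative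
        \<mu> / (k * (y - l) + \<sigma>)) (at y within {l..l + \<eta>})" .
    then show "((\<lambda>y. \<mu> / k * ln (k * (y - l) + \<sigma>)) has_vector_derivative \<mu> / (k * (y - l) + \<sigma>))
        (at y within {l..l + \<eta>})"
      by (simp add: has_real_derivative_iff_has_vector_derivative)
  qed (use assms in simp)
  moreover have "0 < k * \<eta> + \<sigma>" using assms by (intro add_nonneg_pos) auto
  ultimately show ?thesis
    using assms by (simp add: ln_div algebra_simps)
qed

text \<open>
  The difference of two roots is the difference of the radicands, at least \<open>t \<mu>\<close>, divided by the
  sum of the roots; the new root is at most \<open>sqrt (A w) + sqrt (t M)\<close>. The assumption on
  \<open>A w + t M\<close> ensures that no height is cut off at zero.
\<close>

lemma perturbation_gain:
  assumes A: "pos_semidef A" and B: "pos_semidef B" and t: "0 < t" "t < 1"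
    and b: "\<mu> \<le> binary_form B w - binary_form A w" "binary_form B w \<le> M" and "0 \<le> \<mu>"
    and fits: "binary_form A w + t * M \<le> 1 - (norm w)\<^sup>2"
    and pos: "0 < t * M"
  shows "t * \<mu> / (2 * sqrt (binary_form A w) + sqrt (t * M))
    \<le> fiber_height A w - fiber_height ((1 - t) *\<^sub>R A + t *\<^sub>R B) w"
proof -
  let ?s = "binary_form A w" and ?st = "binary_form ((1 - t) *\<^sub>R A + t *\<^sub>R B) w"
  have s: "0 \<le> ?s" "0 \<le> binary_form B w" using A B by (auto intro: pos_semidefD)
  have st: "?st = ?s + t * (binary_form B w - ?s)"
    unfolding binary_form_combination by (simp add: algebra_simps)
  have "t * \<mu> \<le> t * (binary_form B w - ?s)" using t b by (intro mult_left_mono) auto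
  then have lower: "?s + t * \<mu> \<le> ?st" using st by simp
  have "t * (binary_form B w - ?s) \<le> t * M" using t b s by (intro mult_left_mono) auto
  then have upper: "?st \<le> ?s + t * M" using st by simp
  have "0 \<le> t * \<mu>" using t assms(7) by simp
  have sums: "sqrt ?st \<le> sqrt ?s + sqrt (t * M)"
    using upper s pos sqrt_add_le_add_sqrt[of ?s "t * M"] by (meson less_imp_le order_trans real_sqrt_le_mono)
  have pos': "0 < 2 * sqrt ?s + sqrt (t * M)" "0 \<le> sqrt ?st + sqrt ?s"
    using s pos lower \<open>0 \<le> t * \<mu>\<close> by (auto intro!: add_nonneg_pos)
  have le: "sqrt ?s \<le> sqrt ?st" using lower \<open>0 \<le> t * \<mu>\<close> by simp
  have "t * \<mu> \<le> (sqrt ?st)\<^sup>2 - (sqrt ?s)\<^sup>2"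
    using lower s \<open>0 \<le> t * \<mu>\<close> by simp
  also have "\<dots> = (sqrt ?st - sqrt ?s) * (sqrt ?st + sqrt ?s)"
    by (simp add: power2_eq_square algebra_simps)
  also have "\<dots> \<le> (sqrt ?st - sqrt ?s) * (2 * sqrt ?s + sqrt (t * M))"
    using le sums by (intro mult_left_mono) auto
  finally have "t * \<mu> / (2 * sqrt ?s + sqrt (t * M)) \<le> sqrt ?st - sqrt ?s"
    using pos' by (simp add: divide_le_eq)
  also have "\<dots> = fiber_height A w - fiber_height ((1 - t) *\<^sub>R A + t *\<^sub>R B) w"
  proof -
    have "sqrt ?st \<le> sqrt (1 - (norm w)\<^sup>2)" using upper fits by simp
    then show ?thesis using le unfolding fiber_height_def by linarith
  qed
  finally show ?thesis .
qed

text \<open>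
  The form \<open>A\<close> vanishes on the line \<open>y = - \<kappa> x\<close>. On the strip \<open>0 \<le> y + \<kappa> x \<le> \<eta>\<close>,
  \<open>1/4 \<le> x \<le> 1/2\<close>, the form \<open>B\<close> exceeds \<open>A\<close> by a positive constant, so
  \<open>perturbation_gain\<close> applies and integrating in \<open>y\<close> yields the logarithm. Everywhere, convexity
  bounds the increase of the height by \<open>t\<close>, which costs at most \<open>4 t\<close> on the square.
\<close>

lemma degenerate_perturbation:
  assumes form: "\<And>x y. binary_form A (x, y) = \<gamma> * (y + \<kappa> * x)\<^sup>2"
    and \<gamma>: "0 \<le> \<gamma>" and \<kappa>: "\<bar>\<kappa>\<bar> \<le> 1" and B: "pos_def B"
  shows "\<exists>t. 0 < t \<and> t < 1 \<and> half_cone_volume ((1 - t) *\<^sub>R A + t *\<^sub>R B) < half_cone_volume A"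
proof -
  have psdA: "pos_semidef A" unfolding pos_semidef_def using form \<gamma> by (metis mult_nonneg_nonneg prod.collapse zero_le_power2)
  have psdB: "pos_semidef B" using B by (rule pos_def_imp_pos_semidef)
  \<comment> \<open>The strip lies in the annulus \<open>R\<close>; the extrema of \<open>B\<close> on \<open>R\<close> are its uniform bounds there.\<close>
  define R where "R = {w :: real \<times> real. 1/4 \<le> norm w} \<inter> cball 0 1"
  have cont_norm: "closed {w :: real \<times> real. 1/4 \<le> norm w}"
    by (intro closed_Collect_le continuous_intros)
  have R: "compact R"
    unfolding R_def by (intro closed_Int_compact cont_norm compact_cball)
  have "(1, 0) \<in> R" by (simp add: R_def norm_Pair)
  then have "R \<noteq> {}" by blast
  obtain v where v: "v \<in> R" "\<And>w. w \<in> R \<Longrightarrow> binary_form B v \<le> binary_form B w"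
    using continuous_attains_inf[OF R \<open>R \<noteq> {}\<close> continuous_binary_form] by blast
  obtain v' where v': "v' \<in> R" "\<And>w. w \<in> R \<Longrightarrow> binary_form B w \<le> binary_form B v'"
    using continuous_attains_sup[OF R \<open>R \<noteq> {}\<close> continuous_binary_form] by blast
  define m where "m = binary_form B v"
  define M where "M = binary_form B v'"
  have "v \<noteq> 0" using v(1) by (auto simp: R_def)
  then have m: "0 < m" using B unfolding m_def pos_def_def by blast
  have M: "0 < M" using m v(2)[OF v'(1)] by (simp add: m_def M_def)
  \<comment> \<open>The width \<open>\<eta>\<close> keeps the strip away from the unit circle and \<open>A\<close> below \<open>m / 2\<close> on it.\<close>
  define \<Lambda> where "\<Lambda> = 1 + sqrt \<gamma>"
  have \<Lambda>: "1 \<le> \<Lambda>" "sqrt \<gamma> \<le> \<Lambda>" using \<gamma> by (auto simp: \<Lambda>_def)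
  define \<eta> where "\<eta> = min (1/4) (sqrt (m / 2)) / \<Lambda>"
  have \<eta>: "0 < \<eta>" using m \<Lambda> by (simp add: \<eta>_def)
  have \<Lambda>\<eta>: "\<Lambda> * \<eta> \<le> 1/4" "\<Lambda> * \<eta> \<le> sqrt (m / 2)" "\<eta> \<le> 1/4"
  proof -
    have "\<Lambda> * \<eta> = min (1/4) (sqrt (m / 2))" using \<Lambda> by (simp add: \<eta>_def)
    then show *: "\<Lambda> * \<eta> \<le> 1/4" "\<Lambda> * \<eta> \<le> sqrt (m / 2)" by auto
    have "1 * \<eta> \<le> \<Lambda> * \<eta>" using \<Lambda> \<eta> by (intro mult_right_mono) auto
    then show "\<eta> \<le> 1/4" using * by simp
  qed
  \<comment> \<open>\<open>E\<close> is large enough for the integral of the gain over the strip to exceed \<open>4 t\<close>; the three bounds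
    on \<open>t\<close> say \<open>t < 1\<close>, that heights on the strip stay positive, and \<open>E \<sigma> \<le> \<Lambda> \<eta>\<close>.\<close>
  define E where "E = exp (64 * \<Lambda> / m)"
  have E: "0 < E" by (simp add: E_def)
  define t where "t = min (1/2) (min (1 / (8 * M)) ((\<Lambda> * \<eta> / E)\<^sup>2 / M))"
  have t: "0 < t" "t < 1" using M \<Lambda> \<eta> E by (auto simp: t_def)
  have tM: "t * M \<le> 1/8" "t * M \<le> (\<Lambda> * \<eta> / E)\<^sup>2"
  proof -
    have "t * M \<le> 1 / (8 * M) * M" using M by (intro mult_right_mono) (auto simp: t_def)
    then show "t * M \<le> 1/8" using M by simp
    have "t * M \<le> (\<Lambda> * \<eta> / E)\<^sup>2 / M * M" using M by (intro mult_right_mono) (auto simp: t_def)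
    then show "t * M \<le> (\<Lambda> * \<eta> / E)\<^sup>2" using M by simp
  qed
  define \<sigma> where "\<sigma> = sqrt (t * M)"
  have \<sigma>: "0 < \<sigma>" using t M by (simp add: \<sigma>_def)
  have "\<sigma> \<le> \<Lambda> * \<eta> / E"
    unfolding \<sigma>_def using tM(2) \<Lambda> \<eta> E by (intro real_le_lsqrt) auto
  then have \<sigma>E: "E * \<sigma> \<le> \<Lambda> * \<eta>" using E by (simp add: field_simps)
  let ?At = "(1 - t) *\<^sub>R A + t *\<^sub>R B"
  \<comment> \<open>Adding \<open>t\<close> makes the decrease of the height nonnegative, so it may be bounded below by its integral
    over the strip alone.\<close>
  define f where "f w = fiber_height A w - fiber_height ?At w + t" for w
  have f_cont: "continuous_on S f" for S
    unfolding f_def by (intro continuous_intros continuous_fiber_height)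
  have f_nonneg: "0 \<le> f w" for w
  proof -
    have "fiber_height ?At w \<le> (1 - t) * fiber_height A w + t * fiber_height B w"
      using fiber_height_convex psdA psdB t by (simp add: less_imp_le)
    moreover have "(1 - t) * fiber_height A w \<le> 1 * fiber_height A w"
      using t by (intro mult_right_mono) (auto simp: fiber_height_def)
    moreover have "t * fiber_height B w \<le> t * 1"
    proof (intro mult_left_mono)
      have "sqrt (1 - (norm w)\<^sup>2) \<le> sqrt 1" by (subst real_sqrt_le_iff) simp
      moreover have "0 \<le> sqrt (binary_form B w)" using pos_semidefD[OF psdB] by simp
      ultimately show "fiber_height B w \<le> 1" unfolding fiber_height_def real_sqrt_one by linarith
    qed (use t in simp)
    ultimately show ?thesis by (simp add: f_def)
  qed
  have f_int: "integral square f = half_cone_volume A - half_cone_volume ?At + 4 * t"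
  proof -
    have "((\<lambda>w. t) has_integral measure lborel square *\<^sub>R t) square" by (rule has_integral_const)
    moreover have "measure lborel square = 4" by (simp add: content_Pair)
    ultimately have "(f has_integral half_cone_volume A - half_cone_volume ?At + 4 * t) square"
      unfolding f_def half_cone_volume_def
      by (intro has_integral_add has_integral_diff integrable_integral fiber_height_integrable) simp
    then show ?thesis by (rule integral_unique)
  qed
  let ?J = "t * (m / 2) / (2 * \<Lambda>) * ln ((2 * \<Lambda> * \<eta> + \<sigma>) / \<sigma>)"
  have f_lower: "t * (m / 2) / (2 * \<Lambda> * (y - - \<kappa> * x) + \<sigma>) \<le> f (x, y)"
    if x: "x \<in> {1/4..1/2}" and y: "y \<in> {- \<kappa> * x .. - \<kappa> * x + \<eta>}" for x y
  proof -
    let ?w = "(x, y)"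
    define p where "p = y + \<kappa> * x"
    have p: "0 \<le> p" "p \<le> \<eta>" using y by (auto simp: p_def)
    have "\<bar>\<kappa> * x\<bar> \<le> 1 * (1/2)" unfolding abs_mult using \<kappa> x by (intro mult_mono) auto
    then have "\<bar>y\<bar> \<le> 3/4" using p \<Lambda>\<eta>(3) unfolding p_def by linarith
    then have "\<bar>y\<bar>\<^sup>2 \<le> (3/4)\<^sup>2" by (intro power_mono) auto
    moreover have "x\<^sup>2 \<le> (1/2)\<^sup>2" using x by (intro power_mono) auto
    moreover have norm: "(norm ?w)\<^sup>2 = x\<^sup>2 + y\<^sup>2" by (simp add: norm_Pair)
    ultimately have norm_le: "(norm ?w)\<^sup>2 \<le> 13/16" by (simp add: power2_eq_square)
    have "norm ?w \<le> 1" using norm_le power2_le_imp_le[of "norm ?w" 1] by simp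
    moreover have "1/4 \<le> norm ?w" using x norm_fst_le[of x y] by simp
    ultimately have "?w \<in> R" by (simp add: R_def)
    have root: "sqrt (binary_form A ?w) \<le> \<Lambda> * p"
    proof -
      have "sqrt (binary_form A ?w) = sqrt \<gamma> * p"
        using p by (simp add: form real_sqrt_mult p_def)
      also have "\<dots> \<le> \<Lambda> * p" using \<Lambda> p by (intro mult_right_mono) auto
      finally show ?thesis .
    qed
    also have "\<dots> \<le> \<Lambda> * \<eta>" using \<Lambda> p by (intro mult_left_mono) auto
    finally have "sqrt (binary_form A ?w) \<le> 1/4" "sqrt (binary_form A ?w) \<le> sqrt (m / 2)"
      using \<Lambda>\<eta> by linarith+
    then have small: "binary_form A ?w \<le> (1/4)\<^sup>2" "binary_form A ?w \<le> m / 2"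
      by (auto intro: sqrt_le_D simp only: real_sqrt_le_iff)
    have "y - - \<kappa> * x = p" by (simp add: p_def)
    then have "t * (m / 2) / (2 * \<Lambda> * (y - - \<kappa> * x) + \<sigma>) = t * (m / 2) / (2 * \<Lambda> * p + \<sigma>)"
      by (simp only:)
    also have "\<dots> \<le> t * (m / 2) / (2 * sqrt (binary_form A ?w) + \<sigma>)"
      using root \<sigma> t m pos_semidefD[OF psdA, of ?w] \<Lambda> p
      by (intro divide_left_mono mult_pos_pos add_nonneg_pos) auto
    also have "\<dots> \<le> fiber_height A ?w - fiber_height ?At ?w"
      unfolding \<sigma>_def
    proof (rule perturbation_gain[OF psdA psdB t])
      show "m / 2 \<le> binary_form B ?w - binary_form A ?w"
        using small(2) v(2)[OF \<open>?w \<in> R\<close>] by (simp add: m_def)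
      show "binary_form B ?w \<le> M" using v'(2)[OF \<open>?w \<in> R\<close>] by (simp add: M_def)
      show "binary_form A ?w + t * M \<le> 1 - (norm ?w)\<^sup>2"
        using small(1) tM(1) norm_le by (simp add: power2_eq_square)
    qed (use m t M in auto)
    also have "\<dots> \<le> f ?w" using t by (simp add: f_def)
    finally show ?thesis .
  qed
  have inner: "?J \<le> integral {-1..1} (\<lambda>y. f (x, y))" if x: "x \<in> {1/4..1/2}" for x
  proof -
    let ?I = "{- \<kappa> * x .. - \<kappa> * x + \<eta>}"
    have int: "(\<lambda>y. f (x, y)) integrable_on {a..b}" for a b
      by (intro integrable_continuous_interval continuous_on_compose2[OF f_cont] continuous_intros) auto
    have "((\<lambda>y. t * (m / 2) / (2 * \<Lambda> * (y - - \<kappa> * x) + \<sigma>)) has_integral ?J) ?I"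
      using \<Lambda> \<sigma> \<eta> by (intro integral_reciprocal_linear) auto
    then have "?J \<le> integral ?I (\<lambda>y. f (x, y))"
      using int f_lower[OF x] by (intro has_integral_le[OF _ integrable_integral]) auto
    also have "\<dots> \<le> integral {-1..1} (\<lambda>y. f (x, y))"
    proof (rule integral_subset_le)
      have "\<bar>\<kappa> * x\<bar> \<le> 1 * (1/2)" unfolding abs_mult using \<kappa> x by (intro mult_mono) auto
      then show "?I \<subseteq> {-1..1}" using \<Lambda>\<eta>(3) by auto
    qed (use int f_nonneg in auto)
    finally show ?thesis .
  qed
  have "?J / 4 \<le> integral square f"
  proof -
    let ?g = "\<lambda>x. integral {-1..1} (\<lambda>y. f (x, y))"
    have "continuous_on S ?g" for S
      using integral_continuous_on_param[of S "-1::real" 1 "\<lambda>x y. f (x, y)"] f_cont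
      by (simp add: case_prod_unfold)
    then have int: "?g integrable_on {a..b}" for a b by (intro integrable_continuous_interval)
    have "((\<lambda>x. ?J) has_integral (1/2 - 1/4) *\<^sub>R ?J) {1/4..1/2 :: real}"
      using has_integral_const_real[of ?J "1/4" "1/2"] by simp
    then have "?J / 4 \<le> integral {1/4..1/2} ?g"
      using int inner has_integral_le[OF _ integrable_integral, of "\<lambda>x. ?J" _ "{1/4..1/2}" ?g] by force
    also have "\<dots> \<le> integral {-1..1} ?g"
      using int f_nonneg by (intro integral_subset_le) (auto intro!: integral_nonneg
        integrable_continuous_interval continuous_on_compose2[OF f_cont] continuous_intros)
    also have "\<dots> = integral square f"
      by (subst integral_prod_continuous[OF f_cont]) simp
    finally show ?thesis .
  qed
  moreover have "16 * t < ?J"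
  proof -
    have "E * \<sigma> < 2 * \<Lambda> * \<eta> + \<sigma>" using \<sigma>E \<sigma> mult_pos_pos[of \<Lambda> \<eta>] \<Lambda> \<eta> by linarith
    then have "E < (2 * \<Lambda> * \<eta> + \<sigma>) / \<sigma>" using \<sigma> by (simp add: field_simps)
    then have "ln E < ln ((2 * \<Lambda> * \<eta> + \<sigma>) / \<sigma>)" using E by (intro ln_less_cancel_iff[THEN iffD2]) auto
    then have "t * (m / 2) / (2 * \<Lambda>) * (64 * \<Lambda> / m) < ?J"
      using t m \<Lambda> by (intro mult_strict_left_mono) (auto simp: E_def)
    then show ?thesis using m \<Lambda> by simp
  qed
  ultimately have "half_cone_volume ?At < half_cone_volume A" using f_int by simp
  then show ?thesis using t by blast
qed

text \<open>
  A degenerate semidefinite form is a multiple of the square of a linear form. The larger diagonal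
  coefficient may be assumed to be the second, since exchanging the coordinates does not change the
  volume; then the kernel is a line \<open>y = - \<kappa> x\<close> of slope at most one.
\<close>

lemma degenerate_not_minimal:
  assumes A: "pos_semidef A" "\<not> pos_def A" and B: "pos_def B"
  shows "\<exists>t. 0 < t \<and> t < 1 \<and> half_cone_volume ((1 - t) *\<^sub>R A + t *\<^sub>R B) < half_cone_volume A"
proof -
  have main: "\<exists>t. 0 < t \<and> t < 1 \<and> half_cone_volume ((1 - t) *\<^sub>R (\<alpha>, \<beta>, \<gamma>) + t *\<^sub>R B) < half_cone_volume (\<alpha>, \<beta>, \<gamma>)"
    if det: "\<alpha> * \<gamma> = \<beta>\<^sup>2" and nonneg: "0 \<le> \<alpha>" and le: "\<alpha> \<le> \<gamma>" and B: "pos_def B" for \<alpha> \<beta> \<gamma> B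
  proof (rule degenerate_perturbation[OF _ _ _ B])
    have "\<beta>\<^sup>2 \<le> \<gamma>\<^sup>2"
      using det nonneg le mult_right_mono[of \<alpha> \<gamma> \<gamma>] by (simp add: power2_eq_square)
    then have "\<bar>\<beta>\<bar> \<le> \<gamma>" using nonneg le by (simp add: abs_le_square_iff[symmetric])
    then show "\<bar>\<beta> / \<gamma>\<bar> \<le> 1" using nonneg le by (cases "\<gamma> = 0") auto
    show "binary_form (\<alpha>, \<beta>, \<gamma>) (x, y) = \<gamma> * (y + \<beta> / \<gamma> * x)\<^sup>2" for x y
    proof (cases "\<gamma> = 0")
      case True
      then show ?thesis using \<open>\<bar>\<beta>\<bar> \<le> \<gamma>\<close> nonneg le by (simp add: binary_form_def)
    next
      case False
      have "\<gamma> * (y + \<beta> / \<gamma> * x)\<^sup>2 = (\<beta>\<^sup>2 / \<gamma>) * x\<^sup>2 + 2 * \<beta> * x * y + \<gamma> * y\<^sup>2"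
        using False by (simp add: power2_eq_square field_simps)
      also have "\<beta>\<^sup>2 / \<gamma> = \<alpha>" using False det by (simp add: field_simps)
      finally show ?thesis by (simp add: binary_form_def)
    qed
  qed (use nonneg le in simp)
  obtain \<alpha> \<beta> \<gamma> where abc: "A = (\<alpha>, \<beta>, \<gamma>)" by (cases A)
  note disc = pos_semidef_discriminant[OF A(1)[unfolded abc]]
  have det: "\<alpha> * \<gamma> = \<beta>\<^sup>2"
    using A(2) disc unfolding abc pos_def_iff by (cases "\<alpha> = 0") auto
  show ?thesis
  proof (cases "\<alpha> \<le> \<gamma>")
    case True
    then show ?thesis using main[OF det disc(1) True B] by (simp add: abc)
  next
    case False
    obtain a b c where B_abc: "B = (a, b, c)" by (cases B)
    have "pos_def (c, b, a)"
      unfolding pos_def_def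
    proof (intro allI impI)
      fix w :: "real \<times> real" assume "w \<noteq> 0"
      then have "(snd w, fst w) \<noteq> 0" by (auto simp: prod_eq_iff)
      then have "0 < binary_form (a, b, c) (snd w, fst w)" using B unfolding B_abc pos_def_def by blast
      then show "0 < binary_form (c, b, a) w" by (simp add: binary_form_def algebra_simps)
    qed
    then obtain t where t: "0 < t" "t < 1"
      "half_cone_volume ((1 - t) *\<^sub>R (\<gamma>, \<beta>, \<alpha>) + t *\<^sub>R (c, b, a)) < half_cone_volume (\<gamma>, \<beta>, \<alpha>)"
      using main[of \<gamma> \<alpha> \<beta> "(c, b, a)"] det disc(2) False by (auto simp: mult.commute)
    then show ?thesis
      unfolding abc B_abc
      by (intro exI[of _ t]) (simp add: half_cone_volume_swap[of \<gamma>] half_cone_volume_swap[of "(1 - t) * \<gamma> + t * c"])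
  qed
qed

section \<open>The volume of the cone in the unit ball\<close>

definition pole_cone :: "real \<times> real \<times> real \<Rightarrow> (real^3) set"
  where "pole_cone A = {y. binary_form A (y $ 1, y $ 2) \<le> (y $ 3)\<^sup>2}"

lemma closed_pole_cone: "closed (pole_cone A)"
  unfolding pole_cone_def binary_form_def case_prod_unfold
  by (intro closed_Collect_le continuous_intros)

definition from_coords :: "(real \<times> real) \<times> real \<Rightarrow> real^3"
  where "from_coords p = vector [fst (fst p), snd (fst p), snd p]"

lemma from_coords_nth [simp]:
  "from_coords p $ 1 = fst (fst p)" "from_coords p $ 2 = snd (fst p)" "from_coords p $ 3 = snd p"
  by (simp_all add: from_coords_def)

lemma continuous_from_coords: "continuous_on UNIV from_coords"
proof -
  have "continuous_on UNIV (\<lambda>p. from_coords p $ i)" for i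
    using exhaust_3[of i] by (elim disjE) (simp_all, (intro continuous_intros)+)
  then have "continuous_on UNIV (\<lambda>p. \<chi> i. from_coords p $ i)"
    by (rule continuous_on_vec_lambda)
  then show ?thesis by simp
qed

text \<open>
  Identifying \<open>real^3\<close> with a product space gives access to iterated integration there.
\<close>

lemma lborel_from_coords: "distr lborel borel from_coords = lborel"
proof (rule lborel_eqI[symmetric])
  have meas: "from_coords \<in> borel_measurable lborel"
    using borel_measurable_continuous_onI[OF continuous_from_coords] by simp
  fix l u :: "real^3"
  assume le: "\<And>b. b \<in> Basis \<Longrightarrow> l \<bullet> b \<le> u \<bullet> b"
  have nth_le: "l $ i \<le> u $ i" for i
    using le[of "axis i 1"] by (simp add: inner_axis)
  have "from_coords -` box l u = box ((l $ 1, l $ 2), l $ 3) ((u $ 1, u $ 2), u $ 3)"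
    by (auto simp: mem_box_cart forall_3 mem_box Basis_prod_def)
  then have "emeasure (distr lborel borel from_coords) (box l u)
      = emeasure lborel (box ((l $ 1, l $ 2), l $ 3) ((u $ 1, u $ 2), u $ 3))"
    using meas by (subst emeasure_distr) auto
  also have "\<dots> = ennreal ((u $ 1 - l $ 1) * (u $ 2 - l $ 2) * (u $ 3 - l $ 3))"
    using nth_le[of 1] nth_le[of 2] nth_le[of 3] by (subst emeasure_lborel_box) (auto simp: Basis_prod_def inner_diff_left prod.union_disjoint prod.insert algebra_simps)
  also have "(u $ 1 - l $ 1) * (u $ 2 - l $ 2) * (u $ 3 - l $ 3) = (\<Prod>b\<in>Basis. (u - l) \<bullet> b)"
  proof -
    have basis: "(Basis :: (real^3) set) = range (\<lambda>i. axis i 1)"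
      by (auto simp: Basis_vec_def)
    have "(\<Prod>b\<in>Basis. (u - l) \<bullet> b) = (\<Prod>i\<in>UNIV. (u - l) $ i)"
      unfolding basis by (subst prod.reindex) (auto simp: inj_on_def axis_eq_axis inner_axis)
    also have "\<dots> = (u - l) $ 1 * ((u - l) $ 2 * (u - l) $ 3)"
      unfolding UNIV_3 by simp
    finally show ?thesis by (simp only: vector_minus_component mult.assoc)
  qed
  finally show "emeasure (distr lborel borel from_coords) (box l u) = (\<Prod>b\<in>Basis. (u - l) \<bullet> b)" .
qed simp

text \<open>
  With \<open>a = sqrt (A w)\<close> and \<open>r = sqrt (1 - \<bar>w\<bar>\<^sup>2)\<close> the fiber is the interval
  \<open>[- r, r]\<close> without the open interval \<open>(- a, a)\<close>.
\<close>

lemma fiber_length: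
  assumes "pos_semidef A"
  shows "emeasure lborel {z. binary_form A w \<le> z\<^sup>2 \<and> (norm w)\<^sup>2 + z\<^sup>2 \<le> 1} = ennreal (2 * fiber_height A w)"
proof -
  define a where "a = sqrt (binary_form A w)"
  define r where "r = sqrt (1 - (norm w)\<^sup>2)"
  have a: "0 \<le> a" "a\<^sup>2 = binary_form A w" using pos_semidefD[OF assms] by (auto simp: a_def)
  have "{z. binary_form A w \<le> z\<^sup>2 \<and> (norm w)\<^sup>2 + z\<^sup>2 \<le> 1} = {- r..r} - {- a<..<a}" (is "?S = _")
  proof -
    have "binary_form A w \<le> z\<^sup>2 \<longleftrightarrow> \<not> \<bar>z\<bar> < a" for z
      using a abs_le_square_iff[of a z] by auto
    moreover have "(norm w)\<^sup>2 + z\<^sup>2 \<le> 1 \<longleftrightarrow> \<bar>z\<bar> \<le> r" for z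
      using real_sqrt_le_iff[of "z\<^sup>2" "1 - (norm w)\<^sup>2"] by (auto simp: r_def)
    ultimately show ?thesis by (auto simp: abs_le_iff abs_less_iff)
  qed
  also have "emeasure lborel \<dots> = ennreal (2 * fiber_height A w)"
  proof (cases "a \<le> r")
    case True
    have "emeasure lborel ({- r..r} - {- a<..<a}) = emeasure lborel {- r..r} - emeasure lborel {- a<..<a}"
      using True a by (intro emeasure_Diff) auto
    also have "\<dots> = ennreal (2 * (r - a))"
      using True a by (simp add: ennreal_minus algebra_simps)
    finally show ?thesis using True by (simp add: fiber_height_def a_def r_def)
  next
    case False
    then have "{- r..r} - {- a<..<a} = {}" by auto
    then have "emeasure lborel ({- r..r} - {- a<..<a}) = 0" by (simp only: emeasure_empty)
    moreover have "fiber_height A w = 0" using False by (simp add: fiber_height_def a_def r_def)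
    ultimately show ?thesis by simp
  qed
  finally show ?thesis .
qed

lemma volume_pole_cone:
  assumes "pos_semidef A"
  shows "measure lebesgue (cball 0 1 \<inter> pole_cone A) = 2 * half_cone_volume A"
proof -
  let ?S = "cball 0 1 \<inter> pole_cone A"
  let ?P = "from_coords -` ?S"
  have meas: "from_coords \<in> borel_measurable borel"
    using borel_measurable_continuous_onI[OF continuous_from_coords] .
  have S: "?S \<in> sets borel" using closed_pole_cone[of A] by auto
  have P: "?P \<in> sets (lborel \<Otimes>\<^sub>M lborel)"
    using measurable_sets[OF meas S] by (simp only: lborel_prod sets_lborel space_borel Int_UNIV_right)
  have norm_from_coords: "norm (from_coords (w, z)) \<le> 1 \<longleftrightarrow> (norm w)\<^sup>2 + z\<^sup>2 \<le> 1" for w z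
  proof -
    have "(norm (from_coords (w, z)))\<^sup>2 = (norm w)\<^sup>2 + z\<^sup>2"
      unfolding power2_norm_eq_inner by (cases w) (simp add: inner_vec_def sum_3 inner_prod_def power2_eq_square)
    moreover have "norm (from_coords (w, z)) \<le> 1 \<longleftrightarrow> (norm (from_coords (w, z)))\<^sup>2 \<le> 1"
      using abs_square_le_1[of "norm (from_coords (w, z))"] by simp
    ultimately show ?thesis by simp
  qed
  have fiber: "Pair w -` ?P = {z. binary_form A w \<le> z\<^sup>2 \<and> (norm w)\<^sup>2 + z\<^sup>2 \<le> 1}" for w
    by (rule set_eqI) (simp add: pole_cone_def norm_from_coords, blast)
  have fiber_height_outside: "fiber_height A w = 0" if "w \<notin> square" for w
  proof -
    have "norm w > 1"
    proof (rule ccontr)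
      assume "\<not> norm w > 1"
      then have "\<bar>fst w\<bar> \<le> 1" "\<bar>snd w\<bar> \<le> 1"
        using norm_fst_le[of "fst w" "snd w"] norm_snd_le[of "snd w" "fst w"] by auto
      then show False using that by (cases w) (auto simp: cbox_Pair_eq)
    qed
    then have "1 \<le> (norm w)\<^sup>2" by simp
    then have "sqrt (1 - (norm w)\<^sup>2) \<le> 0" by simp
    moreover have "0 \<le> sqrt (binary_form A w)" using pos_semidefD[OF assms] by simp
    ultimately show ?thesis unfolding fiber_height_def by linarith
  qed
  have "(fiber_height A has_integral half_cone_volume A) UNIV"
    using has_integral_on_superset[OF integrable_integral[OF fiber_height_integrable] fiber_height_outside]
    unfolding half_cone_volume_def by simp
  then have int: "((\<lambda>w. 2 * fiber_height A w) has_integral 2 * half_cone_volume A) UNIV"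
    by (rule has_integral_mult_right)
  have nonneg: "0 \<le> 2 * fiber_height A w" for w by (simp add: fiber_height_def)
  have "emeasure lborel ?S = emeasure (distr lborel borel from_coords) ?S"
    by (simp only: lborel_from_coords)
  also have "\<dots> = emeasure lborel ?P"
    using meas S by (subst emeasure_distr) auto
  also have "\<dots> = emeasure (lborel \<Otimes>\<^sub>M lborel) ?P" by (simp only: lborel_prod)
  also have "\<dots> = (\<integral>\<^sup>+w. emeasure lborel (Pair w -` ?P) \<partial>lborel)"
    using P by (rule lborel.emeasure_pair_measure_alt)
  also have "\<dots> = (\<integral>\<^sup>+w. ennreal (2 * fiber_height A w) \<partial>lborel)"
    unfolding fiber fiber_length[OF assms] ..
  also have "\<dots> = ennreal (2 * half_cone_volume A)"
    using int nonneg borel_measurable_continuous_onI[OF continuous_fiber_height]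
    by (intro nn_integral_has_integral_lborel) auto
  finally have "emeasure lborel ?S = ennreal (2 * half_cone_volume A)" .
  moreover have "0 \<le> 2 * half_cone_volume A" using has_integral_nonneg[OF int] nonneg by blast
  ultimately have "measure lborel ?S = 2 * half_cone_volume A" by (simp add: measure_def)
  then show ?thesis using S by simp
qed

section \<open>Lines that meet a conic at most once\<close>

text \<open>
  Inverse of the symmetric matrix that the triple stands for.
\<close>

definition dual_form :: "real \<times> real \<times> real \<Rightarrow> real \<times> real \<times> real"
  where "dual_form B = (case B of (a, b, c) \<Rightarrow>
    (c / (a * c - b\<^sup>2), - b / (a * c - b\<^sup>2), a / (a * c - b\<^sup>2)))"

lemma dual_form:
  assumes "pos_def B"
  shows pos_def_dual_form: "pos_def (dual_form B)" and dual_form_dual_form: "dual_form (dual_form B) = B"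
proof -
  obtain a b c where B: "B = (a, b, c)" by (cases B)
  define d where "d = a * c - b\<^sup>2"
  have d: "0 < d" "0 < a" using assms by (auto simp: B pos_def_iff d_def)
  have "0 < a * c" using d unfolding d_def by (smt (verit) zero_le_power2)
  then have c: "0 < c" using d by (simp add: zero_less_mult_iff)
  have dual: "dual_form B = (c / d, - b / d, a / d)" by (simp add: B dual_form_def d_def)
  have det: "c / d * (a / d) - (- b / d)\<^sup>2 = 1 / d"
  proof -
    have "c / d * (a / d) - (- b / d)\<^sup>2 = (a * c - b\<^sup>2) / (d * d)"
      by (simp add: power2_eq_square diff_divide_distrib mult.commute)
    then show ?thesis using d by (simp add: d_def[symmetric])
  qed
  have "0 < 1 / d" using d by simp
  then have "(- b / d)\<^sup>2 < c / d * (a / d)" using det by linarith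
  then show "pos_def (dual_form B)" using c d by (simp only: dual pos_def_iff) simp
  have "dual_form (c / d, - b / d, a / d) = (a / d / (1 / d), - (- b / d) / (1 / d), c / d / (1 / d))"
    unfolding dual_form_def prod.case det ..
  then show "dual_form (dual_form B) = B" unfolding dual using d by (simp add: B)
qed

text \<open>
  The points of the conic on the line with pole \<open>m\<close> are the isotropic vectors of \<open>B - z\<^sup>2\<close> in
  the plane orthogonal to \<open>m\<close>. With \<open>s = B (- m2, m1)\<close> and the determinant \<open>d\<close> of \<open>B\<close>,
  membership of \<open>m\<close> in the dual cone means \<open>s \<le> d m3\<^sup>2\<close>. Every vector \<open>(x, y, z)\<close> of that
  plane satisfies the Cauchy-Schwarz identity
  \<open>s B (x, y) - d (m1 x + m2 y)\<^sup>2 = (p x + q y)\<^sup>2\<close>, where \<open>m1 x + m2 y = - m3 z\<close>. For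
  isotropic vectors the left side is \<open>(s - d m3\<^sup>2) z\<^sup>2\<close>. If \<open>m\<close> is in the dual cone, then
  \<open>p x + q y = 0\<close>, and this second linear equation leaves at most one direction; only for
  \<open>m1 = m2 = 0\<close> is it void, but then \<open>z = 0\<close> and there are no isotropic vectors. Otherwise
  \<open>s - d m3\<^sup>2\<close> has two square roots, and they give two directions.
\<close>

lemma isotropic_in_plane_at_most_one:
  fixes m :: "real^3"
  assumes "pos_def B" and m: "m \<in> S2"
  shows "(\<forall>y\<in>S2. \<forall>y'\<in>S2. m \<bullet> y = 0 \<longrightarrow> m \<bullet> y' = 0 \<longrightarrow>
      binary_form B (y $ 1, y $ 2) = (y $ 3)\<^sup>2 \<longrightarrow> binary_form B (y' $ 1, y' $ 2) = (y' $ 3)\<^sup>2 \<longrightarrow>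
      y = y' \<or> y = - y') \<longleftrightarrow> m \<in> pole_cone (dual_form B)" (is "?L \<longleftrightarrow> ?R")
proof -
  obtain a b c where B: "B = (a, b, c)" by (cases B)
  define d where "d = a * c - b\<^sup>2"
  have d: "0 < d" using assms by (auto simp: B pos_def_iff d_def)
  define m1 m2 m3 where "m1 = m $ 1" and "m2 = m $ 2" and "m3 = m $ 3"
  define p where "p = b * m1 - a * m2"
  define q where "q = c * m1 - b * m2"
  define s where "s = m1 * q - m2 * p"
  have inner_m: "m \<bullet> y = m1 * y $ 1 + m2 * y $ 2 + m3 * y $ 3" for y
    by (simp add: inner_vec_def sum_3 m1_def m2_def m3_def)
  have s_eq: "s = binary_form B (- m2, m1)"
    by (simp add: s_def p_def q_def B binary_form_def power2_eq_square algebra_simps)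
  have R: "?R \<longleftrightarrow> s \<le> d * m3\<^sup>2"
  proof -
    have "binary_form (dual_form B) (m1, m2) = (c * m1\<^sup>2 - 2 * b * m1 * m2 + a * m2\<^sup>2) / d"
      unfolding B dual_form_def prod.case d_def[symmetric]
      by (simp add: binary_form_def diff_divide_distrib add_divide_distrib)
    also have "c * m1\<^sup>2 - 2 * b * m1 * m2 + a * m2\<^sup>2 = s"
      by (simp add: s_def p_def q_def power2_eq_square algebra_simps)
    finally have "binary_form (dual_form B) (m1, m2) = s / d" .
    then show ?thesis
      using d by (simp add: pole_cone_def m1_def[symmetric] m2_def[symmetric] m3_def[symmetric]
          divide_le_eq mult.commute)
  qed
  show ?thesis
  proof
    assume ?R
    then have le: "s \<le> d * m3\<^sup>2" using R by simp
    show ?L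
    proof (cases "m1 = 0 \<and> m2 = 0")
      case True
      then have "m3 \<noteq> 0"
        using m unfolding m1_def m2_def m3_def by (auto simp: vec_eq_iff forall_3 norm_eq_sqrt_inner inner_vec_def sum_3)
      have False if "y \<in> S2" "m \<bullet> y = 0" "binary_form B (y $ 1, y $ 2) = (y $ 3)\<^sup>2" for y
      proof -
        have "y $ 3 = 0" using that(2) True \<open>m3 \<noteq> 0\<close> by (simp add: inner_m)
        then have "(y $ 1, y $ 2) = 0" using that(3) assms(1) unfolding pos_def_def by (metis less_irrefl zero_power2)
        then have "y = 0" using \<open>y $ 3 = 0\<close> by (simp add: vec_eq_iff forall_3 prod_eq_iff)
        then show False using that(1) by simp
      qed
      then show ?thesis by blast
    next
      case False
      then have s: "0 < s" unfolding s_eq using assms(1) unfolding pos_def_def by (auto simp: prod_eq_iff)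
      \<comment> \<open>The only candidate direction, normalized to have third coordinate one.\<close>
      define v :: "real^3" where "v = vector [- (q * m3 / s), p * m3 / s, 1]"
      have multiple: "y = y $ 3 *\<^sub>R v" if "m \<bullet> y = 0" "binary_form B (y $ 1, y $ 2) = (y $ 3)\<^sup>2" for y
      proof -
        have my: "m1 * y $ 1 + m2 * y $ 2 = - (m3 * y $ 3)" using that(1) by (simp add: inner_m)
        have "(p * y $ 1 + q * y $ 2)\<^sup>2
            = s * binary_form B (y $ 1, y $ 2) - d * (m1 * y $ 1 + m2 * y $ 2)\<^sup>2"
          by (simp add: s_def p_def q_def d_def B binary_form_def power2_eq_square algebra_simps)
        also have "\<dots> = (s - d * m3\<^sup>2) * (y $ 3)\<^sup>2"
          unfolding that(2) my by (simp add: power2_eq_square algebra_simps)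
        also have "\<dots> \<le> 0" using le by (simp add: mult_nonpos_nonneg)
        finally have "p * y $ 1 + q * y $ 2 = 0" by simp
        then have *: "q * y $ 2 = - (p * y $ 1)" "p * y $ 1 = - (q * y $ 2)" by linarith+
        have "s * y $ 1 = m1 * (q * y $ 1) - m2 * (p * y $ 1)" by (simp add: s_def algebra_simps)
        also have "\<dots> = q * (m1 * y $ 1 + m2 * y $ 2)" unfolding *(2) by (simp add: algebra_simps)
        finally have y1: "s * y $ 1 = - (q * m3) * y $ 3" unfolding my by simp
        have "s * y $ 2 = m1 * (q * y $ 2) - m2 * (p * y $ 2)" by (simp add: s_def algebra_simps)
        also have "\<dots> = - p * (m1 * y $ 1 + m2 * y $ 2)" unfolding *(1) by (simp add: algebra_simps)
        finally have y2: "s * y $ 2 = p * m3 * y $ 3" unfolding my by simp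
        have "y $ 1 = y $ 3 * (- (q * m3 / s))" "y $ 2 = y $ 3 * (p * m3 / s)"
          using y1 y2 s by (simp_all add: field_simps)
        then show ?thesis by (simp add: vec_eq_iff forall_3 v_def)
      qed
      show ?thesis
      proof (intro ballI impI)
        fix y y' :: "real^3"
        assume y: "y \<in> S2" "y' \<in> S2" and "m \<bullet> y = 0" "m \<bullet> y' = 0"
          "binary_form B (y $ 1, y $ 2) = (y $ 3)\<^sup>2" "binary_form B (y' $ 1, y' $ 2) = (y' $ 3)\<^sup>2"
        then have eq: "y = y $ 3 *\<^sub>R v" "y' = y' $ 3 *\<^sub>R v" using multiple by blast+
        have "norm (y $ 3 *\<^sub>R v) = norm (y' $ 3 *\<^sub>R v)" unfolding eq[symmetric] using y by simp
        moreover have "v \<noteq> 0" by (auto simp: v_def vec_eq_iff forall_3)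
        ultimately have "y $ 3 = y' $ 3 \<or> y $ 3 = - y' $ 3" by (simp add: abs_eq_iff)
        then show "y = y' \<or> y = - y'" using eq by (metis scaleR_minus_left)
      qed
    qed
  next
    assume L: ?L
    show ?R
    proof (rule ccontr)
      assume "\<not> ?R"
      then have less: "d * m3\<^sup>2 < s" using R by simp
      moreover have "0 \<le> d * m3\<^sup>2" using d by simp
      ultimately have s: "0 < s" by linarith
      define r where "r = sqrt (s - d * m3\<^sup>2)"
      have r: "0 < r" "r\<^sup>2 = s - d * m3\<^sup>2" using less by (auto simp: r_def)
      \<comment> \<open>\<open>u r\<close> and \<open>u (- r)\<close> solve the two equations \<open>m \<bullet> u = 0\<close> and
        \<open>p x + q y = t s\<close> with third coordinate \<open>s\<close>.\<close>
      define u :: "real \<Rightarrow> real^3"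
        where "u t = vector [- m3 * q - t * m2, m3 * p + t * m1, s]" for t
      have u_nth: "u t $ 1 = - m3 * q - t * m2" "u t $ 2 = m3 * p + t * m1" "u t $ 3 = s" for t
        by (simp_all add: u_def)
      have u0: "u t \<noteq> 0" for t using u_nth(3)[of t] s by auto
      have u_m: "m \<bullet> u t = 0" for t
        unfolding inner_m u_nth by (simp add: s_def algebra_simps)
      have u_B: "binary_form B (u t $ 1, u t $ 2) = (u t $ 3)\<^sup>2" if "t\<^sup>2 = r\<^sup>2" for t
      proof -
        have "binary_form B (u t $ 1, u t $ 2) = d * m3\<^sup>2 * s + t\<^sup>2 * s"
          unfolding u_nth by (simp add: s_def p_def q_def d_def B binary_form_def power2_eq_square algebra_simps)
        also have "\<dots> = s * s" unfolding that r(2) by (simp add: algebra_simps)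
        finally show ?thesis by (simp add: u_nth power2_eq_square)
      qed
      define y where "y t = (1 / norm (u t)) *\<^sub>R u t" for t
      have y: "y t \<in> S2" "m \<bullet> y t = 0" for t using u0 u_m by (simp_all add: y_def)
      have y_B: "binary_form B (y t $ 1, y t $ 2) = (y t $ 3)\<^sup>2" if "t\<^sup>2 = r\<^sup>2" for t
      proof -
        have "(y t $ 1, y t $ 2) = (1 / norm (u t)) *\<^sub>R (u t $ 1, u t $ 2)" by (simp add: y_def)
        then show ?thesis
          by (simp only: binary_form_scaleR u_B[OF that]) (simp add: y_def power_divide)
      qed
      have y3: "0 < y t $ 3" for t using s u0 by (simp add: y_def u_nth)
      have "y r = y (- r) \<or> y r = - y (- r)"
        using L y y_B[of r] y_B[of "- r"] by auto
      moreover have "y r \<noteq> - y (- r)" using y3[of r] y3[of "- r"] by auto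
      ultimately have yy: "y r = y (- r)" by blast
      have "norm (u r) *\<^sub>R y r = u r" "norm (u (- r)) *\<^sub>R y (- r) = u (- r)" using u0 by (simp_all add: y_def)
      then have "norm (u r) * y r $ 3 = s" "norm (u (- r)) * y r $ 3 = s"
        using u_nth(3) yy by (metis vector_scaleR_component real_scaleR_def)+
      then have "norm (u r) = norm (u (- r))" using y3[of r] by (metis less_irrefl mult_right_cancel)
      then have "u r = u (- r)" using \<open>norm (u r) *\<^sub>R y r = u r\<close> \<open>norm (u (- r)) *\<^sub>R y (- r) = u (- r)\<close> yy by metis
      then have "u r $ 1 = u (- r) $ 1" "u r $ 2 = u (- r) $ 2" by simp_all
      then have "m1 = 0" "m2 = 0" using r(1) by (simp_all add: u_nth)
      then show False using s by (simp add: s_def)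
    qed
  qed
qed

section \<open>Conics with a given center\<close>

definition block_matrix :: "real \<times> real \<times> real \<Rightarrow> real^3^3"
  where "block_matrix B = (case B of (a, b, c) \<Rightarrow>
    vector [vector [a, b, 0], vector [b, c, 0], vector [0, 0, - 1]])"

lemma block_matrix_quadratic:
  "y \<bullet> (block_matrix B *v y) = binary_form B (y $ 1, y $ 2) - (y $ 3)\<^sup>2"
  by (cases B) (simp add: block_matrix_def binary_form_def inner_vec_def matrix_vector_mult_def
      sum_3 power2_eq_square algebra_simps)

lemma det_block_matrix:
  "det (mat t - block_matrix (a, b, c)) = ((t - a) * (t - c) - b\<^sup>2) * (t + 1)"
  by (simp add: det_3 block_matrix_def mat_def power2_eq_square algebra_simps)

(* Coordinates with respect to the columns of Q are written transpose Q *v x throughout. *)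
declare transpose_matrix_vector [simp del]

lemma matrix_vector_mult_minus: "M *v (- x) = - (M *v (x :: real^'n))"
  by (rule linear_neg[OF matrix_vector_mul_linear])

lemma orthogonal_matrix_isometry:
  fixes Q :: "real^'n^'n"
  assumes "orthogonal_matrix Q"
  shows "transpose Q *v (Q *v x) = x" "Q *v (transpose Q *v x) = x"
    "(transpose Q *v x) \<bullet> (transpose Q *v y) = x \<bullet> y"
    "norm (transpose Q *v x) = norm x" "norm (Q *v x) = norm x"
proof -
  show 1: "transpose Q *v (Q *v x) = x" for x
    using assms unfolding orthogonal_matrix_def by (simp add: matrix_vector_mul_assoc)
  show 2: "Q *v (transpose Q *v x) = x" for x
    using assms unfolding orthogonal_matrix_def by (simp add: matrix_vector_mul_assoc)
  show inner: "(transpose Q *v x) \<bullet> (transpose Q *v y) = x \<bullet> y" for x y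
    by (metis 2 dot_lmul_matrix transpose_matrix_vector)
  show norm: "norm (transpose Q *v x) = norm x" for x
    by (simp add: norm_eq_sqrt_inner inner)
  show "norm (Q *v x) = norm x" using norm[of "Q *v x"] by (simp add: 1)
qed

lemma det_orthogonal_conjugate:
  fixes Q :: "real^'n^'n"
  assumes "orthogonal_matrix Q"
  shows "det (mat t - Q ** D ** transpose Q) = det (mat t - D)"
proof -
  have "mat t - Q ** D ** transpose Q = Q ** (mat t - D) ** transpose Q"
  proof -
    have "Q ** mat t ** transpose Q = mat t"
    proof -
      have "Q ** mat t ** transpose Q *v x = mat t *v x" for x
      proof -
        have "mat t *v y = t *\<^sub>R y" for y :: "real^'n"
          by (simp add: vec_eq_iff matrix_vector_mult_def mat_def if_distrib if_distribR cong: if_cong)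
        then show ?thesis
          by (simp add: matrix_vector_mul_assoc[symmetric] matrix_vector_mult_scaleR
              orthogonal_matrix_isometry[OF assms])
      qed
      then show ?thesis by (simp add: matrix_eq)
    qed
    moreover have "Q ** (mat t - D) ** transpose Q = Q ** mat t ** transpose Q - Q ** D ** transpose Q"
      by (simp add: matrix_eq matrix_vector_mul_assoc[symmetric] matrix_vector_mult_diff_rdistrib matrix_vector_mult_diff_distrib)
    ultimately show ?thesis by simp
  qed
  moreover have "det Q * det (transpose Q) = 1"
    using assms unfolding orthogonal_matrix_def by (metis det_I det_mul)
  ultimately show ?thesis by (simp add: det_mul mult.commute mult.left_commute)
qed

text \<open>
  The conic is parametrized by the dual of its form, since its containment conditions are linear in
  the dual form. The last column of \<open>Q\<close> spans its center.
\<close>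

definition centered_conic :: "real^3^3 \<Rightarrow> real \<times> real \<times> real \<Rightarrow> (real^3) set"
  where "centered_conic Q A = conic_of (Q ** block_matrix (dual_form A) ** transpose Q)"

text \<open>
  If \<open>M\<close> has eigenvector \<open>e\<close> for \<open>- 1\<close>, symmetry makes it block diagonal in a basis that ends
  with \<open>e\<close>. Comparing characteristic polynomials, the trace and determinant of the upper block are
  those of the pair \<open>\<nu>1\<close>, \<open>\<nu>2\<close>, so the block is positive definite. Conversely the
  eigenvalues of a positive definite block are \<open>(a + c +- h) / 2\<close> with
  \<open>h\<^sup>2 = (a - c)\<^sup>2 + 4 b\<^sup>2\<close>.
\<close>

lemma conic_with_center_iff:
  assumes Q: "orthogonal_matrix Q" "Q *v axis 3 1 = e"
  shows "conic_with_center C (proj e) \<longleftrightarrow> (\<exists>A. pos_def A \<and> C = centered_conic Q A)"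
proof
  assume "conic_with_center C (proj e)"
  then obtain M \<nu>1 \<nu>2 e' where M: "conic_matrix M \<nu>1 \<nu>2" "C = conic_of M"
    and e': "M *v e' = - e'" "proj e = proj e'"
    unfolding conic_with_center_def by blast
  from e'(2) have "e = e' \<or> e = - e'" by (simp only: proj_eq_iff)
  then have Me: "M *v e = - e"
    using e'(1) by (elim disjE) (simp_all only: matrix_vector_mult_minus)
  define D where "D = transpose Q ** M ** Q"
  have M_eq: "M = Q ** D ** transpose Q"
    by (simp only: matrix_eq D_def matrix_vector_mul_assoc[symmetric] orthogonal_matrix_isometry(1,2)[OF Q(1)])
      simp
  have D_sym: "transpose D = D"
  proof -
    have "transpose M = M" using M(1) unfolding conic_matrix_def by blast
    then show ?thesis by (simp only: D_def matrix_transpose_mul transpose_transpose matrix_mul_assoc)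
  qed
  have sym: "D $ i $ j = D $ j $ i" for i j
  proof -
    have "transpose D $ i $ j = D $ j $ i" by (simp add: transpose_def)
    then show ?thesis by (simp only: D_sym)
  qed
  have "transpose Q *v e = axis 3 1"
    unfolding Q(2)[symmetric] by (rule orthogonal_matrix_isometry(1)[OF Q(1)])
  then have "D *v axis 3 1 = - axis 3 1"
    by (simp only: D_def matrix_vector_mul_assoc[symmetric] Q(2) Me matrix_vector_mult_minus)
  have col: "D $ i $ 3 = - (axis 3 1 :: real^3) $ i" for i
  proof -
    have "D $ i $ 3 = (D *v axis 3 1) $ i" by (simp add: matrix_vector_mult_basis column_def)
    then show ?thesis by (simp only: \<open>D *v axis 3 1 = - axis 3 1\<close> vector_uminus_component)
  qed
  define a b c where "a = D $ 1 $ 1" and "b = D $ 1 $ 2" and "c = D $ 2 $ 2"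
  have D_block: "D = block_matrix (a, b, c)"
    using col[of 1] col[of 2] col[of 3] sym[of 1 2] sym[of 3 1] sym[of 3 2]
    by (simp add: vec_eq_iff forall_3 block_matrix_def a_def b_def c_def axis_def)
  have char: "((t - a) * (t - c) - b\<^sup>2) * (t + 1) = (t - \<nu>1) * (t - \<nu>2) * (t + 1)" for t
  proof -
    have "((t - a) * (t - c) - b\<^sup>2) * (t + 1) = det (mat t - M)"
      unfolding M_eq det_orthogonal_conjugate[OF Q(1)] D_block det_block_matrix ..
    then show ?thesis using M(1) by (simp add: conic_matrix_def)
  qed
  \<comment> \<open>The values of the characteristic polynomial at \<open>0\<close> and \<open>1\<close> give determinant and trace.\<close>
  have prod: "a * c - b\<^sup>2 = \<nu>1 * \<nu>2" using char[of 0] by simp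
  have "(1 - a) * (1 - c) - b\<^sup>2 = (1 - \<nu>1) * (1 - \<nu>2)" using char[of 1] by simp
  then have sum: "a + c = \<nu>1 + \<nu>2" using prod by (simp add: algebra_simps)
  have pos: "0 < \<nu>1" "0 < \<nu>2" using M(1) by (auto simp: conic_matrix_def)
  have less: "b\<^sup>2 < a * c" using prod pos mult_pos_pos[of \<nu>1 \<nu>2] by linarith
  then have "0 < a * c" using zero_le_power2[of b] by linarith
  then have "0 < a" using sum pos by (auto simp: zero_less_mult_iff)
  then have "pos_def (a, b, c)" using less by (simp add: pos_def_iff)
  then show "\<exists>A. pos_def A \<and> C = centered_conic Q A"
    using M_eq M(2) unfolding D_block centered_conic_def
    by (metis pos_def_dual_form dual_form_dual_form)
next
  assume "\<exists>A. pos_def A \<and> C = centered_conic Q A"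
  then obtain A where A: "pos_def A" "C = centered_conic Q A" by blast
  obtain a b c where B: "dual_form A = (a, b, c)" by (cases "dual_form A")
  define M where "M = Q ** block_matrix (a, b, c) ** transpose Q"
  have abc: "0 < a" "b\<^sup>2 < a * c" using pos_def_dual_form[OF A(1)] by (simp_all add: B pos_def_iff)
  then have "0 < a * c" using zero_le_power2[of b] by linarith
  then have "0 < c" using abc by (simp add: zero_less_mult_iff)
  define h where "h = sqrt ((a - c)\<^sup>2 + 4 * b\<^sup>2)"
  have h: "0 \<le> h" "h\<^sup>2 = (a - c)\<^sup>2 + 4 * b\<^sup>2" by (simp_all add: h_def)
  have "0 < 4 * (a * c - b\<^sup>2)" using abc by simp
  also have "\<dots> = (a + c)\<^sup>2 - h\<^sup>2"
    unfolding h(2) by (simp add: power2_eq_square algebra_simps)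
  finally have "h\<^sup>2 < (a + c)\<^sup>2" by (simp only: diff_gt_0_iff_gt)
  then have h_less: "h < a + c" using abc \<open>0 < c\<close> by (intro power2_less_imp_less[of h]) auto
  have "transpose (block_matrix (a, b, c)) = block_matrix (a, b, c)"
    by (simp add: vec_eq_iff forall_3 block_matrix_def transpose_def)
  then have "transpose M = M" by (simp only: M_def matrix_transpose_mul transpose_transpose matrix_mul_assoc)
  moreover have "det (mat t - M) = (t - (a + c + h) / 2) * (t - (a + c - h) / 2) * (t - (- 1))" for t
  proof -
    have "(t - (a + c + h) / 2) * (t - (a + c - h) / 2) = t\<^sup>2 - (a + c) * t + ((a + c)\<^sup>2 - h\<^sup>2) / 4"
      by (simp add: power2_eq_square field_simps)
    also have "\<dots> = (t - a) * (t - c) - b\<^sup>2"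
      unfolding h(2) by (simp add: power2_eq_square field_simps)
    finally show ?thesis
      unfolding M_def det_orthogonal_conjugate[OF Q(1)] det_block_matrix by simp
  qed
  ultimately have "conic_matrix M ((a + c + h) / 2) ((a + c - h) / 2)"
    using h(1) h_less by (simp add: conic_matrix_def)
  moreover have "M *v e = - e"
  proof -
    have "block_matrix (a, b, c) *v axis 3 1 = - axis 3 1"
      by (simp add: vec_eq_iff forall_3 block_matrix_def matrix_vector_mult_def sum_3 axis_def)
    then show ?thesis
      unfolding Q(2)[symmetric] M_def
      by (simp add: matrix_vector_mul_assoc[symmetric] orthogonal_matrix_isometry[OF Q(1)] matrix_vector_mult_minus)
  qed
  moreover have "e \<in> S2" using orthogonal_matrix_isometry(5)[OF Q(1)] by (simp add: Q(2)[symmetric])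
  ultimately show "conic_with_center C (proj e)"
    unfolding conic_with_center_def A(2) centered_conic_def B M_def[symmetric] by blast
qed

section \<open>The measure of a conic\<close>

definition polar_line :: "real^3 \<Rightarrow> elliptic_point set"
  where "polar_line n = line_of_plane {x. n \<bullet> x = 0}"

lemma dim_polar_plane: "n \<in> S2 \<Longrightarrow> dim {x :: real^3. n \<bullet> x = 0} = 2"
  by (subst dim_hyperplane) auto

lemma pole_polar_line: "n \<in> S2 \<Longrightarrow> pole (polar_line n) = proj n"
  unfolding polar_line_def
  by (rule pole_line_of_plane) (simp_all add: subspace_hyperplane dim_polar_plane)

lemma elliptic_lines_eq: "elliptic_lines = polar_line ` S2"
proof (intro subset_antisym subsetI)
  fix L assume "L \<in> elliptic_lines"
  then obtain W where W: "subspace W" "dim W = 2" "L = line_of_plane W"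
    unfolding elliptic_lines_def by blast
  have "dim W < DIM(real^3)" using W(2) by simp
  then obtain z where z: "z \<noteq> 0" "\<And>y. y \<in> span W \<Longrightarrow> orthogonal z y"
    by (rule orthogonal_to_subspace_exists) blast
  define n where "n = (1 / norm z) *\<^sub>R z"
  have n: "n \<in> S2" using z(1) by (simp add: n_def)
  have "W \<subseteq> {x. n \<bullet> x = 0}"
    using z(2) span_base by (auto simp: n_def orthogonal_def)
  then have "W = {x. n \<bullet> x = 0}"
    using W n by (intro subspace_dim_equal) (simp_all add: subspace_hyperplane dim_polar_plane)
  then show "L \<in> polar_line ` S2" using n W(3) by (simp add: polar_line_def)
next
  fix L assume "L \<in> polar_line ` S2"
  then show "L \<in> elliptic_lines"
    unfolding elliptic_lines_def polar_line_def
    using subspace_hyperplane dim_polar_plane by blast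
qed

lemma conic_of_conjugate:
  assumes "orthogonal_matrix Q"
  shows "x \<in> conic_of (Q ** block_matrix B ** transpose Q) \<longleftrightarrow>
    x \<in> S2 \<and> binary_form B ((transpose Q *v x) $ 1, (transpose Q *v x) $ 2) = ((transpose Q *v x) $ 3)\<^sup>2"
proof -
  let ?y = "transpose Q *v x"
  have "x \<bullet> ((Q ** block_matrix B ** transpose Q) *v x) = x \<bullet> (Q *v (block_matrix B *v ?y))"
    by (simp only: matrix_vector_mul_assoc matrix_mul_assoc)
  also have "\<dots> = ?y \<bullet> (block_matrix B *v ?y)"
    by (metis dot_lmul_matrix transpose_matrix_vector)
  also have "\<dots> = binary_form B (?y $ 1, ?y $ 2) - (?y $ 3)\<^sup>2" by (rule block_matrix_quadratic)
  finally show ?thesis by (auto simp: conic_of_def)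
qed

text \<open>
  The isometry \<open>Q\<close> carries the count of intersection points over to coordinates, where
  \<open>isotropic_in_plane_at_most_one\<close> applies to the form of the conic, the dual of \<open>A\<close>.
\<close>

lemma at_most_one_intersection_iff:
  assumes Q: "orthogonal_matrix Q" and A: "pos_def A" and n: "n \<in> S2"
  shows "at_most_one_intersection (centered_conic Q A) (polar_line n) \<longleftrightarrow>
    transpose Q *v n \<in> pole_cone A"
proof -
  let ?C = "centered_conic Q A" and ?B = "dual_form A"
  let ?m = "transpose Q *v n"
  let ?iso = "\<lambda>y. binary_form ?B (y $ 1, y $ 2) = (y $ 3 :: real)\<^sup>2"
  note cancel = orthogonal_matrix_isometry[OF Q]
  have C: "x \<in> ?C \<longleftrightarrow> x \<in> S2 \<and> ?iso (transpose Q *v x)" for x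
    unfolding centered_conic_def by (rule conic_of_conjugate[OF Q])
  have C_neg: "- x \<in> ?C \<longleftrightarrow> x \<in> ?C" for x
    unfolding C matrix_vector_mult_minus
    using binary_form_scaleR[of ?B "- 1" "((transpose Q *v x) $ 1, (transpose Q *v x) $ 2)"] by simp
  have point: "p \<in> polar_line n \<inter> proj ` ?C \<longleftrightarrow> (\<exists>x\<in>?C. n \<bullet> x = 0 \<and> p = proj x)" for p
  proof
    assume "p \<in> polar_line n \<inter> proj ` ?C"
    then obtain x where x: "x \<in> ?C" "p = proj x" "proj x \<in> polar_line n" by blast
    then have "x \<in> S2" using C by blast
    then have "n \<bullet> x = 0"
      using x(3) proj_mem_line_of_plane[OF subspace_hyperplane] unfolding polar_line_def by blast
    then show "\<exists>x\<in>?C. n \<bullet> x = 0 \<and> p = proj x" using x by blast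
  next
    assume "\<exists>x\<in>?C. n \<bullet> x = 0 \<and> p = proj x"
    then show "p \<in> polar_line n \<inter> proj ` ?C"
      using C by (auto simp: polar_line_def line_of_plane_def)
  qed
  have "at_most_one_intersection ?C (polar_line n) \<longleftrightarrow>
      (\<forall>x\<in>?C. \<forall>x'\<in>?C. n \<bullet> x = 0 \<longrightarrow> n \<bullet> x' = 0 \<longrightarrow> proj x = proj x')"
    unfolding at_most_one_intersection_def Uniq_def point by blast
  also have "\<dots> \<longleftrightarrow> (\<forall>y\<in>S2. \<forall>y'\<in>S2. ?m \<bullet> y = 0 \<longrightarrow> ?m \<bullet> y' = 0 \<longrightarrow> ?iso y \<longrightarrow> ?iso y' \<longrightarrow>
      y = y' \<or> y = - y')" (is "?lhs \<longleftrightarrow> ?rhs")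
  proof
    assume L: ?lhs
    show ?rhs
    proof (intro ballI impI)
      fix y y' assume y: "y \<in> S2" "y' \<in> S2" "?m \<bullet> y = 0" "?m \<bullet> y' = 0" "?iso y" "?iso y'"
      have "n \<bullet> (Q *v z) = ?m \<bullet> z" for z using cancel(3)[of n "Q *v z"] by (simp only: cancel(1))
      then have "n \<bullet> (Q *v y) = 0" "n \<bullet> (Q *v y') = 0" using y by simp_all
      moreover have "Q *v y \<in> ?C" "Q *v y' \<in> ?C"
        using y unfolding C by (simp_all add: cancel(1,5))
      ultimately have "proj (Q *v y) = proj (Q *v y')" using L by blast
      then have "Q *v y = Q *v y' \<or> Q *v y = Q *v (- y')"
        by (simp only: proj_eq_iff matrix_vector_mult_minus)
      then show "y = y' \<or> y = - y'" by (metis cancel(1))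
    qed
  next
    assume R: ?rhs
    show ?lhs
    proof (intro ballI impI)
      fix x x' assume x: "x \<in> ?C" "x' \<in> ?C" "n \<bullet> x = 0" "n \<bullet> x' = 0"
      let ?y = "transpose Q *v x" and ?y' = "transpose Q *v x'"
      have "?y \<in> S2" "?y' \<in> S2" "?iso ?y" "?iso ?y'" using x unfolding C by (simp_all add: cancel(4))
      moreover have "?m \<bullet> ?y = 0" "?m \<bullet> ?y' = 0" using x by (simp_all only: cancel(3))
      ultimately have "?y = ?y' \<or> ?y = - ?y'" using R by blast
      then have "?y = ?y' \<or> ?y = transpose Q *v (- x')" by (simp only: matrix_vector_mult_minus)
      then show "proj x = proj x'" unfolding proj_eq_iff by (metis cancel(2))
    qed
  qed
  also have "\<dots> \<longleftrightarrow> ?m \<in> pole_cone (dual_form ?B)"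
    using isotropic_in_plane_at_most_one[OF pos_def_dual_form[OF A], of ?m] n by (simp add: cancel(4))
  finally show ?thesis by (simp only: dual_form_dual_form[OF A])
qed

lemma pole_cone_scaleR: "y \<in> pole_cone A \<Longrightarrow> t *\<^sub>R y \<in> pole_cone A"
  using binary_form_scaleR[of A t "(y $ 1, y $ 2)"]
  by (simp add: pole_cone_def power_mult_distrib mult_left_mono)

text \<open>
  The poles of the lines that meet the conic at most once fill the image of \<open>pole_cone A\<close> under \<open>Q\<close>, and the
  solid cone that defines the area of this set is its part in the unit ball. The factors \<open>3\<close> of
  \<open>sphere_area\<close>, \<open>1 / 2\<close> of \<open>elliptic_area\<close> and \<open>2\<close> of \<open>volume_pole_cone\<close>
  give the constant.
\<close>

lemma conic_measure_centered_conic: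
  assumes Q: "orthogonal_matrix Q" and A: "pos_def A"
  shows "conic_measure (centered_conic Q A) = 3 * half_cone_volume A"
proof -
  let ?C = "centered_conic Q A"
  note cancel = orthogonal_matrix_isometry[OF Q]
  let ?K = "{x. transpose Q *v x \<in> pole_cone A}"
  have lines: "{L \<in> elliptic_lines. at_most_one_intersection ?C L} = polar_line ` (S2 \<inter> ?K)"
    using at_most_one_intersection_iff[OF Q A] unfolding elliptic_lines_eq by auto
  have "pole ` polar_line ` (S2 \<inter> ?K) = proj ` (S2 \<inter> ?K)"
    unfolding image_image by (intro image_cong) (simp_all add: pole_polar_line)
  then have poles: "pole ` {L \<in> elliptic_lines. at_most_one_intersection ?C L} = proj ` (S2 \<inter> ?K)"
    unfolding lines .
  have K_scale: "t *\<^sub>R x \<in> ?K" if "x \<in> ?K" for t x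
    using that pole_cone_scaleR by (simp add: matrix_vector_mult_scaleR)
  have "{x \<in> S2. proj x \<in> proj ` (S2 \<inter> ?K)} = S2 \<inter> ?K"
    using K_scale[of _ "- 1"] by (auto simp: proj_eq_iff matrix_vector_mult_minus)
  moreover have "{t *\<^sub>R x | t x. 0 \<le> t \<and> t \<le> 1 \<and> x \<in> S2 \<inter> ?K} = cball 0 1 \<inter> ?K"
  proof (intro equalityI subsetI)
    fix y assume "y \<in> {t *\<^sub>R x | t x. 0 \<le> t \<and> t \<le> 1 \<and> x \<in> S2 \<inter> ?K}"
    then show "y \<in> cball 0 1 \<inter> ?K" using K_scale by fastforce
  next
    fix y assume y: "y \<in> cball 0 1 \<inter> ?K"
    show "y \<in> {t *\<^sub>R x | t x. 0 \<le> t \<and> t \<le> 1 \<and> x \<in> S2 \<inter> ?K}"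
    proof (cases "y = 0")
      case True
      have "Q *v axis 3 1 \<in> ?K"
        by (simp add: cancel(1) pole_cone_def binary_form_def case_prod_unfold axis_def)
      moreover have "Q *v axis 3 1 \<in> S2" by (simp add: cancel(5))
      ultimately show ?thesis
        using True by (intro CollectI exI[of _ 0] exI[of _ "Q *v axis 3 1"]) auto
    next
      case False
      then have "y = norm y *\<^sub>R ((1 / norm y) *\<^sub>R y)" "(1 / norm y) *\<^sub>R y \<in> S2 \<inter> ?K"
        using y K_scale by auto
      then show ?thesis
        using y by (intro CollectI exI[of _ "norm y"] exI[of _ "(1 / norm y) *\<^sub>R y"]) auto
    qed
  qed
  moreover have "cball 0 1 \<inter> ?K = (\<lambda>y. Q *v y) ` (cball 0 1 \<inter> pole_cone A)"
  proof (intro equalityI subsetI)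
    fix x assume x: "x \<in> cball 0 1 \<inter> ?K"
    then have "transpose Q *v x \<in> cball 0 1 \<inter> pole_cone A" by (simp add: cancel(4))
    then show "x \<in> (\<lambda>y. Q *v y) ` (cball 0 1 \<inter> pole_cone A)" by (metis cancel(2) image_eqI)
  next
    fix x assume "x \<in> (\<lambda>y. Q *v y) ` (cball 0 1 \<inter> pole_cone A)"
    then show "x \<in> cball 0 1 \<inter> ?K" by (auto simp: cancel(1,5))
  qed
  moreover have "measure lebesgue ((\<lambda>y. Q *v y) ` (cball 0 1 \<inter> pole_cone A)) = 2 * half_cone_volume A"
  proof -
    have "cball 0 1 \<inter> pole_cone A \<in> lmeasurable"
      by (intro lmeasurable_compact compact_Int_closed compact_cball closed_pole_cone)
    moreover have "orthogonal_transformation (\<lambda>y. Q *v y)"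
      using Q orthogonal_transformation_matrix[of "\<lambda>y. Q *v y"] by simp
    ultimately show ?thesis
      using measure_orthogonal_image volume_pole_cone[OF pos_def_imp_pos_semidef[OF A]] by metis
  qed
  ultimately have "sphere_area {x \<in> S2. proj x \<in> proj ` (S2 \<inter> ?K)} = 3 * (2 * half_cone_volume A)"
    unfolding sphere_area_def by (simp only:)
  then show ?thesis
    unfolding conic_measure_def line_measure_def elliptic_area_def poles by simp
qed

section \<open>The minimal form\<close>

text \<open>
  By the parallelogram law the two sides differ by the value at \<open>s v - t w\<close>.
\<close>

lemma pos_semidef_add_le:
  assumes "pos_semidef A"
  shows "binary_form A (s *\<^sub>R v + t *\<^sub>R w) \<le> 2 * s\<^sup>2 * binary_form A v + 2 * t\<^sup>2 * binary_form A w"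
proof -
  have "binary_form A (s *\<^sub>R v + t *\<^sub>R w) + binary_form A (s *\<^sub>R v - t *\<^sub>R w)
      = 2 * s\<^sup>2 * binary_form A v + 2 * t\<^sup>2 * binary_form A w"
    by (simp add: binary_form_def case_prod_unfold power2_eq_square algebra_simps)
  then show ?thesis using pos_semidefD[OF assms, of "s *\<^sub>R v - t *\<^sub>R w"] by linarith
qed

lemma independent_projections:
  fixes N :: "(real^3) set"
  assumes "\<And>p. p \<noteq> 0 \<Longrightarrow> \<exists>m\<in>N. fst p * m $ 1 + snd p * m $ 2 \<noteq> 0"
  obtains m m' where "m \<in> N" "m' \<in> N" "m $ 1 * m' $ 2 - m $ 2 * m' $ 1 \<noteq> (0::real)"
proof -
  obtain m where m: "m \<in> N" "m $ 1 \<noteq> 0"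
    using assms[of "(1, 0)"] by (auto simp: prod_eq_iff)
  then obtain m' where "m' \<in> N" "- m $ 2 * m' $ 1 + m $ 1 * m' $ 2 \<noteq> 0"
    using assms[of "(- m $ 2, m $ 1)"] by (auto simp: prod_eq_iff)
  then show thesis using that[OF m(1)] by (simp add: algebra_simps)
qed

text \<open>
  Two of the unit vectors in \<open>N\<close> have independent projections \<open>w\<close>, \<open>w'\<close> to the first two
  coordinates. The constraints bound the form at both, hence at every combination of them, in
  particular at the coordinate vectors; the off-diagonal entry is controlled by the discriminant.
\<close>

lemma compact_enclosing_forms:
  assumes sub: "N \<subseteq> S2" and spanning: "\<And>p. p \<noteq> 0 \<Longrightarrow> \<exists>m\<in>N. fst p * m $ 1 + snd p * m $ 2 \<noteq> 0"
  shows "compact {A. pos_semidef A \<and> N \<subseteq> pole_cone A}"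
proof -
  obtain m m' where m: "m \<in> N" "m' \<in> N" and "m $ 1 * m' $ 2 - m $ 2 * m' $ 1 \<noteq> 0"
    by (rule independent_projections[OF spanning])
  define d where "d = m $ 1 * m' $ 2 - m $ 2 * m' $ 1"
  have d: "d \<noteq> 0" using \<open>_ \<noteq> 0\<close> by (simp add: d_def)
  define w w' where "w = (m $ 1, m $ 2)" and "w' = (m' $ 1, m' $ 2)"
  have component: "(u $ i)\<^sup>2 \<le> 1" if "u \<in> N" for u i
    using that sub component_le_norm_cart[of u i] by (auto simp: abs_square_le_1)
  have bound: "norm A \<le> 12 / d\<^sup>2" if "pos_semidef A" "N \<subseteq> pole_cone A" for A
  proof -
    obtain a b c where abc: "A = (a, b, c)" by (cases A)
    have "binary_form A (u $ 1, u $ 2) \<le> 1" if "u \<in> N" for u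
      using \<open>N \<subseteq> pole_cone A\<close> that component[OF that, of 3] by (force simp: pole_cone_def)
    then have le: "binary_form A w \<le> 1" "binary_form A w' \<le> 1"
      using m by (simp_all add: w_def w'_def)
    have "d\<^sup>2 * a = binary_form A (m' $ 2 *\<^sub>R w + (- m $ 2) *\<^sub>R w')"
      by (simp add: abc binary_form_def w_def w'_def d_def power2_eq_square algebra_simps)
    also have "\<dots> \<le> 2 * (m' $ 2)\<^sup>2 * binary_form A w + 2 * (- m $ 2)\<^sup>2 * binary_form A w'"
      by (rule pos_semidef_add_le[OF that(1)])
    also have "\<dots> \<le> 2 * 1 * 1 + 2 * 1 * 1"
      using le component m pos_semidefD[OF that(1)] by (intro add_mono mult_mono) auto
    finally have "d\<^sup>2 * a \<le> 4" by simp
    then have a: "a \<le> 4 / d\<^sup>2" using d by (simp add: field_simps)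
    have "d\<^sup>2 * c = binary_form A ((- m' $ 1) *\<^sub>R w + m $ 1 *\<^sub>R w')"
      by (simp add: abc binary_form_def w_def w'_def d_def power2_eq_square algebra_simps)
    also have "\<dots> \<le> 2 * (- m' $ 1)\<^sup>2 * binary_form A w + 2 * (m $ 1)\<^sup>2 * binary_form A w'"
      by (rule pos_semidef_add_le[OF that(1)])
    also have "\<dots> \<le> 2 * 1 * 1 + 2 * 1 * 1"
      using le component m pos_semidefD[OF that(1)] by (intro add_mono mult_mono) auto
    finally have "d\<^sup>2 * c \<le> 4" by simp
    then have c: "c \<le> 4 / d\<^sup>2" using d by (simp add: field_simps)
    note disc = pos_semidef_discriminant[OF that(1)[unfolded abc]]
    have "a * c \<le> 4 / d\<^sup>2 * (4 / d\<^sup>2)" using a c disc by (intro mult_mono) auto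
    then have "b\<^sup>2 \<le> (4 / d\<^sup>2)\<^sup>2" using disc(3) by (simp add: power2_eq_square)
    then have "\<bar>b\<bar> \<le> 4 / d\<^sup>2" by (rule abs_le_square_iff[THEN iffD2, of b "4 / d\<^sup>2", simplified])
    moreover have "norm A \<le> norm a + (norm b + norm c)"
      unfolding abc by (intro order_trans[OF norm_Pair_le] add_left_mono norm_Pair_le)
    ultimately show ?thesis using a c disc by simp
  qed
  have "{A. pos_semidef A \<and> N \<subseteq> pole_cone A}
      = {A. \<forall>w. 0 \<le> binary_form A w} \<inter> (\<Inter>m\<in>N. {A. binary_form A (m $ 1, m $ 2) \<le> (m $ 3)\<^sup>2})"
    by (auto simp: pos_semidef_def pole_cone_def)
  moreover have "closed \<dots>"
    by (intro closed_Int closed_INT ballI closed_Collect_all closed_Collect_le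
        continuous_binary_form_coeffs continuous_on_const)
  ultimately have "closed {A. pos_semidef A \<and> N \<subseteq> pole_cone A}" by simp
  moreover have "bounded {A. pos_semidef A \<and> N \<subseteq> pole_cone A}"
    unfolding bounded_iff using bound by blast
  ultimately show ?thesis by (simp add: compact_eq_bounded_closed)
qed

lemma enclosing_forms_convex:
  assumes "pos_semidef A" "pos_semidef B" "N \<subseteq> pole_cone A" "N \<subseteq> pole_cone B" "0 \<le> t" "t \<le> 1"
  shows "pos_semidef ((1 - t) *\<^sub>R A + t *\<^sub>R B)" "N \<subseteq> pole_cone ((1 - t) *\<^sub>R A + t *\<^sub>R B)"
proof -
  show "pos_semidef ((1 - t) *\<^sub>R A + t *\<^sub>R B)"
    using assms unfolding pos_semidef_def binary_form_combination by (intro allI add_nonneg_nonneg mult_nonneg_nonneg) auto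
  show "N \<subseteq> pole_cone ((1 - t) *\<^sub>R A + t *\<^sub>R B)"
  proof
    fix m assume "m \<in> N"
    then have "binary_form A (m $ 1, m $ 2) \<le> (m $ 3)\<^sup>2" "binary_form B (m $ 1, m $ 2) \<le> (m $ 3)\<^sup>2"
      using assms by (auto simp: pole_cone_def)
    then have "(1 - t) * binary_form A (m $ 1, m $ 2) + t * binary_form B (m $ 1, m $ 2)
        \<le> (1 - t) * (m $ 3)\<^sup>2 + t * (m $ 3)\<^sup>2"
      using assms by (intro add_mono mult_left_mono) auto
    also have "\<dots> = (m $ 3)\<^sup>2" by (simp add: algebra_simps)
    finally show "m \<in> pole_cone ((1 - t) *\<^sub>R A + t *\<^sub>R B)"
      unfolding pole_cone_def binary_form_combination by simp
  qed
qed

text \<open>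
  The minimum is taken over the compact set of semidefinite forms. A degenerate minimizer is excluded
  by moving towards \<open>A0\<close>, a second minimizer by moving to the midpoint; both stay admissible
  because the admissible forms are convex.
\<close>

lemma unique_minimal_form:
  assumes "N \<subseteq> S2" "\<And>p. p \<noteq> 0 \<Longrightarrow> \<exists>m\<in>N. fst p * m $ 1 + snd p * m $ 2 \<noteq> 0"
    and A0: "pos_def A0" "N \<subseteq> pole_cone A0"
  shows "\<exists>!A. is_arg_min half_cone_volume (\<lambda>A. pos_def A \<and> N \<subseteq> pole_cone A) A"
proof -
  let ?F = "{A. pos_semidef A \<and> N \<subseteq> pole_cone A}"
  have A0': "A0 \<in> ?F" using A0 pos_def_imp_pos_semidef by blast
  obtain A where A: "A \<in> ?F" "\<And>B. B \<in> ?F \<Longrightarrow> half_cone_volume A \<le> half_cone_volume B"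
    using continuous_attains_inf[OF compact_enclosing_forms[OF assms(1,2)] _ continuous_half_cone_volume] A0'
    by blast
  have "pos_def A"
  proof (rule ccontr)
    assume "\<not> pos_def A"
    then obtain t where t: "0 < t" "t < 1" "half_cone_volume ((1 - t) *\<^sub>R A + t *\<^sub>R A0) < half_cone_volume A"
      using degenerate_not_minimal A(1) A0(1) by blast
    then have "(1 - t) *\<^sub>R A + t *\<^sub>R A0 \<in> ?F" using enclosing_forms_convex[of A A0 N t] A(1) A0' by auto
    then show False using A(2) t(3) by fastforce
  qed
  show ?thesis
  proof (rule ex1I)
    show "is_arg_min half_cone_volume (\<lambda>A. pos_def A \<and> N \<subseteq> pole_cone A) A"
      unfolding is_arg_min_linorder using A \<open>pos_def A\<close> pos_def_imp_pos_semidef by blast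
  next
    fix B assume B: "is_arg_min half_cone_volume (\<lambda>A. pos_def A \<and> N \<subseteq> pole_cone A) B"
    then have B': "B \<in> ?F" "half_cone_volume B \<le> half_cone_volume A"
      unfolding is_arg_min_linorder using A(1) \<open>pos_def A\<close> pos_def_imp_pos_semidef by blast+
    show "B = A"
    proof (rule ccontr)
      assume "B \<noteq> A"
      then have "2 * half_cone_volume ((1/2) *\<^sub>R B + (1/2) *\<^sub>R A) < half_cone_volume B + half_cone_volume A"
        using half_cone_volume_strictly_midpoint_convex A(1) B'(1) by blast
      moreover have "(1/2) *\<^sub>R B + (1/2) *\<^sub>R A \<in> ?F"
        using enclosing_forms_convex[of B A N "1/2"] A(1) B'(1) by auto
      ultimately show False using A(2) B'(2) by fastforce
    qed
  qed
qed

theorem corollary11: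
  fixes \<L> :: "elliptic_point set set" and c :: elliptic_point
  assumes lines: "\<L> \<subseteq> elliptic_lines"
    and bounded: "elliptic_bounded (pole ` \<L>)"
    and compact: "compactin elliptic_topology (pole ` \<L>)"
    and full_dim: "full_dimensional (pole ` \<L>)"
    and center: "c \<in> elliptic_plane"
    and nonempty: "\<exists>C. conic_with_center C c \<and> contains_lines C \<L>"
  shows "\<exists>!C. is_arg_min conic_measure (\<lambda>C. conic_with_center C c \<and> contains_lines C \<L>) C"
proof -
  obtain e where e: "e \<in> S2" "c = proj e"
    using center by (auto simp: elliptic_plane_def)
  then obtain Q :: "real^3^3" where Q: "orthogonal_matrix Q" "Q *v axis 3 1 = e"
    using orthogonal_matrix_exists_basis[of e 3] by auto
  note cancel = orthogonal_matrix_isometry[OF Q(1)]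
  define P where "P = {n \<in> S2. polar_line n \<in> \<L>}"
  define N where "N = (\<lambda>n. transpose Q *v n) ` P"
  have P: "\<L> = polar_line ` P"
    using lines unfolding elliptic_lines_eq P_def by auto
  have N_sub: "N \<subseteq> S2" by (auto simp: N_def P_def cancel(4))
  have contains: "contains_lines (centered_conic Q A) \<L> \<longleftrightarrow> N \<subseteq> pole_cone A" if "pos_def A" for A
    using at_most_one_intersection_iff[OF Q(1) that]
    unfolding contains_lines_def P N_def by (auto simp: P_def)
  \<comment> \<open>If all poles had coordinates orthogonal to \<open>(p, 0)\<close>, they would lie on the polar line of that vector.\<close>
  have spanning: "\<exists>m\<in>N. fst p * m $ 1 + snd p * m $ 2 \<noteq> 0" if "p \<noteq> 0" for p
  proof (rule ccontr)
    assume none: "\<not> (\<exists>m\<in>N. fst p * m $ 1 + snd p * m $ 2 \<noteq> 0)"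
    define v :: "real^3" where "v = vector [fst p, snd p, 0]"
    have "v \<noteq> 0" using that by (auto simp: v_def vec_eq_iff forall_3 prod_eq_iff)
    define z where "z = (1 / norm v) *\<^sub>R (Q *v v)"
    have "z \<in> S2" using \<open>v \<noteq> 0\<close> by (simp add: z_def cancel(5))
    have "pole ` \<L> \<subseteq> polar_line z"
    proof
      fix q assume "q \<in> pole ` \<L>"
      then obtain n where n: "n \<in> P" "q = proj n" unfolding P by (auto simp: P_def pole_polar_line)
      have "v \<bullet> (transpose Q *v n) = 0"
        using none n(1) by (auto simp: N_def v_def inner_vec_def sum_3)
      then have "(Q *v v) \<bullet> n = 0" using cancel(3)[of "Q *v v" n] by (simp only: cancel(1))
      then show "q \<in> polar_line z"
        using n by (auto simp: polar_line_def line_of_plane_def z_def P_def)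
    qed
    then show False
      using full_dim \<open>z \<in> S2\<close> unfolding full_dimensional_def elliptic_lines_eq by blast
  qed
  have conics: "conic_with_center C c \<and> contains_lines C \<L> \<longleftrightarrow>
      (\<exists>A. pos_def A \<and> N \<subseteq> pole_cone A \<and> C = centered_conic Q A)" for C
    unfolding e(2) conic_with_center_iff[OF Q] using contains by blast
  obtain A0 where "pos_def A0" "N \<subseteq> pole_cone A0" using nonempty conics by blast
  with unique_minimal_form[OF N_sub spanning]
  have "\<exists>!A. is_arg_min half_cone_volume (\<lambda>A. pos_def A \<and> N \<subseteq> pole_cone A) A" by blast
  then obtain A where A: "is_arg_min half_cone_volume (\<lambda>A. pos_def A \<and> N \<subseteq> pole_cone A) A"
    and unique: "\<And>B. is_arg_min half_cone_volume (\<lambda>A. pos_def A \<and> N \<subseteq> pole_cone A) B \<Longrightarrow> B = A"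
    by blast
  have arg_min: "is_arg_min conic_measure (\<lambda>C. conic_with_center C c \<and> contains_lines C \<L>) C \<longleftrightarrow>
      (\<exists>B. is_arg_min half_cone_volume (\<lambda>A. pos_def A \<and> N \<subseteq> pole_cone A) B \<and> C = centered_conic Q B)" for C
  proof
    assume C: "is_arg_min conic_measure (\<lambda>C. conic_with_center C c \<and> contains_lines C \<L>) C"
    then obtain B where B: "pos_def B" "N \<subseteq> pole_cone B" "C = centered_conic Q B"
      unfolding is_arg_min_linorder conics by blast
    have "half_cone_volume B \<le> half_cone_volume B'" if "pos_def B'" "N \<subseteq> pole_cone B'" for B'
    proof -
      have "conic_measure C \<le> conic_measure (centered_conic Q B')"
        using C that unfolding is_arg_min_linorder conics by blast
      then show ?thesis
        unfolding B(3) conic_measure_centered_conic[OF Q(1) B(1)]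
          conic_measure_centered_conic[OF Q(1) that(1)] by simp
    qed
    then show "\<exists>B. is_arg_min half_cone_volume (\<lambda>A. pos_def A \<and> N \<subseteq> pole_cone A) B \<and> C = centered_conic Q B"
      unfolding is_arg_min_linorder using B by blast
  next
    assume "\<exists>B. is_arg_min half_cone_volume (\<lambda>A. pos_def A \<and> N \<subseteq> pole_cone A) B \<and> C = centered_conic Q B"
    then obtain B where B: "pos_def B" "N \<subseteq> pole_cone B" "C = centered_conic Q B"
      and min: "\<And>B'. pos_def B' \<Longrightarrow> N \<subseteq> pole_cone B' \<Longrightarrow> half_cone_volume B \<le> half_cone_volume B'"
      unfolding is_arg_min_linorder by blast
    have "conic_measure C \<le> conic_measure (centered_conic Q B')"
      if "pos_def B'" "N \<subseteq> pole_cone B'" for B'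
      unfolding B(3) conic_measure_centered_conic[OF Q(1) B(1)]
        conic_measure_centered_conic[OF Q(1) that(1)] using min[OF that] by simp
    then show "is_arg_min conic_measure (\<lambda>C. conic_with_center C c \<and> contains_lines C \<L>) C"
      unfolding is_arg_min_linorder conics using B by blast
  qed
  show ?thesis unfolding arg_min using A unique by blast
qed

end
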